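(* For each positive integer $n$ divisible by $3$, let $h(n)$ be the number of Hamilton cycles in $C_3(T_1,T_2,T_3)$, where $T_1, T_2, T_3$ are transitive tournaments on $\frac{n}{3}$ vertices each. Then, as $n\to\infty$ through multiples of $3$, $$h(n) \;\sim\; \frac{1}{1-\log 2}\cdot\frac{(n-1)!}{(3\log 2)^n},$$ that is, the ratio of the two sides tends to $1$. (Numerically, $\frac{1}{1-\log 2}\simeq 3.25889$ and $3\log 2\simeq 2.07944$.)
   Context: Here $\log$ is the natural logarithm. A tournament is an oriented complete graph on a finite vertex set: for every pair of distinct vertices $u,v$ exactly one of the directed edges $u\to v$, $v\to u$ is present (and there are no loops). A tournament is transitive if it contains no directed cycle; up to isomorphism there is exactly one transitive tournament on a given number of vertices, so $h(n)$ is well defined. A Hamilton cycle in a tournament $T$ is a directed cycle in $T$ passing through every vertex of $T$ exactly once; Hamilton cycles are counted as subgraphs (sets of directed edges), so cyclic shifts of a vertex listing give the same cycle. Given tournaments $T_1, T_2, T_3$ on pairwise disjoint vertex sets, $C_3(T_1,T_2,T_3)$ denotes the tournament whose vertex set is the union of the three vertex sets, which contains all directed edges of $T_1$, $T_2$, $T_3$, and in which every edge between different parts is oriented from $T_1$ to $T_2$, from $T_2$ to $T_3$, and from $T_3$ to $T_1$. *)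

theory Defs
  imports "Graph_Theory.Pair_Digraph" "HOL-Library.Landau_Symbols" Complex_Main
begin

locale tournament = pair_digraph G for G :: "'a pair_pre_digraph" +
  assumes ex1_arc: "\<lbrakk>u \<in> pverts G; v \<in> pverts G; u \<noteq> v\<rbrakk>
    \<Longrightarrow> ((u, v) \<in> parcs G) \<noteq> ((v, u) \<in> parcs G)"

locale transitive_tournament = tournament G for G :: "'a pair_pre_digraph" +
  assumes acyclic: "\<nexists>p. cycle p"

definition C3 :: "'a pair_pre_digraph \<Rightarrow> 'a pair_pre_digraph \<Rightarrow> 'a pair_pre_digraph \<Rightarrow> 'a pair_pre_digraph"
  where "C3 T1 T2 T3 =
    \<lparr> pverts = pverts T1 \<union> pverts T2 \<union> pverts T3,
      parcs = parcs T1 \<union> parcs T2 \<union> parcs T3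
        \<union> pverts T1 \<times> pverts T2 \<union> pverts T2 \<times> pverts T3 \<union> pverts T3 \<times> pverts T1 \<rparr>"

text \<open>
  A closed walk satisfying \<open>pre_digraph.cycle\<close> is a nonempty list of arcs that
  repeats no vertex, and its vertices are the tails of its arcs. Different
  starting points on the same cycle give different lists but the same set of arcs.
\<close>
definition hamilton_cycles :: "'a pair_pre_digraph \<Rightarrow> 'a rel set"
  where "hamilton_cycles G =
    {set p | p. pre_digraph.cycle (with_proj G) p \<and> fst ` set p = pverts G}"

definition transitive_triple ::
    "nat \<Rightarrow> 'a pair_pre_digraph \<Rightarrow> 'a pair_pre_digraph \<Rightarrow> 'a pair_pre_digraph \<Rightarrow> bool"
  where "transitive_triple m T1 T2 T3 \<longleftrightarrow>
    (\<forall>T \<in> {T1, T2, T3}. transitive_tournament T \<and> card (pverts T) = m) \<and>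
    pverts T1 \<inter> pverts T2 = {} \<and> pverts T2 \<inter> pverts T3 = {} \<and> pverts T3 \<inter> pverts T1 = {}"

text \<open>
  Vertices are natural numbers here only because a constant needs a fixed vertex
  type. That the common value exists is not built in; for \<open>n\<close> not divisible by 3
  the value is irrelevant.
\<close>
definition h :: "nat \<Rightarrow> nat"
  where "h n = (THE k. \<forall>T1 T2 T3 :: nat pair_pre_digraph.
    transitive_triple (n div 3) T1 T2 T3 \<longrightarrow> card (hamilton_cycles (C3 T1 T2 T3)) = k)"

end

(*
  A Hamilton cycle that uses k of the arcs from T3 to T1 cuts every part into k paths, and a path in
  a transitive tournament is just a set of vertices. Cutting the cycle at one of these k arcs yields
  ordered partitions of the three parts into k blocks, so with s(m, k) the number of surjections from
  m onto k elements, h(3m) is the sum over k of s(m, k)^3 / k.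

  By Cauchy's formula on the circle of radius ln 2, s(m, k) (ln 2)^m / m! is the k-fold convolution
  at m of the Poisson distribution with parameter ln 2 conditioned to be nonzero. A local limit
  theorem describes it for k close to m / (2 ln 2), and one integration by parts shows that it decays
  like 1 / |m - 2 k ln 2|. Dominated convergence turns the sum of the cubes into a Gaussian integral.
  The same local limit theorem for the Poisson distribution gives Stirling's formula, which converts
  m!^3 into (3m - 1)!.
*)
theory Submission
  imports Defs "HOL-Probability.Probability" "HOL-Complex_Analysis.Complex_Analysis" "HOL-Real_Asymp.Real_Asymp"
begin

section \<open>A local limit theorem\<close>

text \<open>The radius \<open>ln 2\<close> is the one at which exp r - 1 = 1. There the factor (exp
  r - 1)^k of Cauchy's estimate is 1, so one normalisation by (ln 2)^m / m! serves all k at once and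
  no factor exponential in k has to be balanced. It is also the saddle point for the dominant k: the
  conditioned Poisson variable has mean r exp r / (exp r - 1) = 2 ln 2, which is m / k at the peak.
  The obstacle is uniformity in k. The local limit theorem says nothing far from the peak, and the
  plain bound of order 1 / sqrt k loses a factor sqrt m when its cubes are summed over k of order m.
  With the decay in |m - 2 k ln 2|, two of the three factors already give the integrable majorant 1
  / (1 + y^2), so no exponential tail estimate enters. Origin of the constant: with mean \<mu> = 2
  ln 2 and variance v = 2 ln 2 (1 - ln 2), the Gaussian integral is \<mu> / (2 pi v sqrt 3);
  Stirling's formula contributes 2 pi sqrt 3, and \<mu> / v = 1 / (1 - ln 2) remains.\<close>

lemma integrable_gaussian:
  assumes "c > 0" shows "integrable lborel (\<lambda>y. exp (- c * y\<^sup>2) :: real)"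
proof -
  have "integrable lborel (\<lambda>y. sqrt (pi / c) * normal_density 0 (sqrt (1 / (2 * c))) y)"
    using assms by (intro integrable_mult_right integrable_normal_density) auto
  also have "(\<lambda>y. sqrt (pi / c) * normal_density 0 (sqrt (1 / (2 * c))) y) = (\<lambda>y. exp (- c * y\<^sup>2))"
    using assms by (auto simp: normal_density_def field_simps real_sqrt_divide real_sqrt_mult)
  finally show ?thesis .
qed

text \<open>The characteristic function of the standard normal law, rescaled by
  \<open>sqrt v\<close>.\<close>

lemma integral_gaussian_cis:
  assumes "v > 0"
  shows "(LINT y|lborel. exp (- (v * y\<^sup>2 / 2)) *\<^sub>R cis (- \<xi> * y))
    = complex_of_real (sqrt (2 * pi / v) * exp (- \<xi>\<^sup>2 / (2 * v)))"
proof -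
  have "char std_normal_distribution (- \<xi> / sqrt v)
    = (LINT x|lborel. std_normal_density x *\<^sub>R iexp (- \<xi> / sqrt v * x))"
    unfolding char_def by (subst integral_density) auto
  also have "\<dots> = \<bar>sqrt v\<bar> *\<^sub>R (LINT x|lborel. std_normal_density (0 + sqrt v * x) *\<^sub>R iexp (- \<xi> / sqrt v * (0 + sqrt v * x)))"
    using assms by (intro lborel_integral_real_affine) auto
  also have "\<dots> = \<bar>sqrt v\<bar> *\<^sub>R (LINT y|lborel. (1 / sqrt (2 * pi)) *\<^sub>R (exp (- (v * y\<^sup>2 / 2)) *\<^sub>R cis (- \<xi> * y)))"
  proof (rule arg_cong2[where f=scaleR, OF refl], rule Bochner_Integration.integral_cong[OF refl])
    fix y
    have "iexp (- \<xi> / sqrt v * (0 + sqrt v * y)) = cis (- \<xi> * y)"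
      using assms by (simp add: cis_conv_exp mult_ac)
    moreover have "std_normal_density (0 + sqrt v * y) = (1 / sqrt (2 * pi)) * exp (- (v * y\<^sup>2 / 2))"
      using assms by (simp add: std_normal_density_def power_mult_distrib)
    ultimately show "std_normal_density (0 + sqrt v * y) *\<^sub>R iexp (- \<xi> / sqrt v * (0 + sqrt v * y))
      = (1 / sqrt (2 * pi)) *\<^sub>R (exp (- (v * y\<^sup>2 / 2)) *\<^sub>R cis (- \<xi> * y))"
      by (simp del: of_real_mult of_real_divide)
  qed
  also have "\<dots> = (sqrt v / sqrt (2 * pi)) *\<^sub>R (LINT y|lborel. (exp (- (v * y\<^sup>2 / 2)) *\<^sub>R cis (- \<xi> * y)))"
    using assms by (subst integral_scaleR_right) (simp del: scaleR_scaleR add: scaleR_scaleR[of "sqrt v" "1 / sqrt (2*pi)"])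
  finally have *: "complex_of_real (exp (- (\<xi> / sqrt v)\<^sup>2 / 2)) = (sqrt v / sqrt (2 * pi)) *\<^sub>R (LINT y|lborel. (exp (- (v * y\<^sup>2 / 2)) *\<^sub>R cis (- \<xi> * y)))"
    by (simp add: char_std_normal_distribution)
  have "(LINT y|lborel. (exp (- (v * y\<^sup>2 / 2)) *\<^sub>R cis (- \<xi> * y)))
     = (sqrt (2 * pi) / sqrt v) *\<^sub>R complex_of_real (exp (- (\<xi> / sqrt v)\<^sup>2 / 2))"
    unfolding * using assms by simp
  then show ?thesis using assms
    by (simp add: real_sqrt_divide power_divide scaleR_conv_of_real mult.commute)
qed

text \<open>Substituting \<theta> = y / sqrt k gives an integrand that is dominated by exp (-c y^2)
  and tends to exp (-v y^2 / 2) cis (-\<xi> y). Here \<psi> stands for a centred characteristic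
  function of variance v: \<open>loc\<close> is its second-order expansion, and \<open>dom\<close>,
  on all of [-pi, pi], also covers the region away from 0. The indices \<open>k\<close> and the
  offsets \<open>x\<close> are arbitrary sequences, since the result is applied both along k = n
  with offset 0 and along indices that follow a rescaled integration variable.\<close>

lemma fourier_local_limit:
  fixes \<psi> :: "real \<Rightarrow> complex" and k :: "nat \<Rightarrow> nat" and x :: "nat \<Rightarrow> real"
  assumes cont: "continuous_on UNIV \<psi>" and c: "c > 0" and v: "v > 0"
    and dom: "\<And>\<theta>. \<bar>\<theta>\<bar> \<le> pi \<Longrightarrow> norm (\<psi> \<theta>) \<le> exp (- c * \<theta>\<^sup>2)"
    and loc: "((\<lambda>\<theta>. (\<psi> \<theta> - exp (- (v * \<theta>\<^sup>2 / 2))) / \<theta>\<^sup>2) \<longlongrightarrow> 0) (at 0)"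
    and k: "filterlim k at_top sequentially" and x: "x \<longlonglongrightarrow> \<xi>"
  shows "(\<lambda>n. sqrt (k n) *\<^sub>R (LINT \<theta>:{-pi..pi}|lborel. \<psi> \<theta> ^ k n * cis (- (x n * sqrt (k n) * \<theta>))))
     \<longlonglongrightarrow> complex_of_real (sqrt (2 * pi / v) * exp (- \<xi>\<^sup>2 / (2 * v)))"
proof -
  have [measurable]: "\<psi> \<in> borel_measurable borel"
    using cont by (simp add: borel_measurable_continuous_onI)
  have [measurable]: "cis \<in> borel_measurable borel"
    by (intro borel_measurable_continuous_onI continuous_intros)
  \<comment> \<open>For k n = 0 the rescaled integrand would have norm 1 everywhere; the value 0
    keeps the Gaussian domination true for every n, not just eventually.\<close>
  define G where "G n y = (if k n = 0 then 0 else
     indicator {-pi..pi} (y / sqrt (k n)) *\<^sub>R (\<psi> (y / sqrt (k n)) ^ k n * cis (- (x n * y))))" for n y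
  have kr: "filterlim (\<lambda>n. real (k n)) at_top sequentially"
    using k filterlim_compose filterlim_real_sequentially by blast
  have kpos: "eventually (\<lambda>n. k n > 0) sequentially"
    using k eventually_gt_at_top[of 0] unfolding filterlim_iff by blast
  have eq: "sqrt (k n) *\<^sub>R (LINT \<theta>:{-pi..pi}|lborel. \<psi> \<theta> ^ k n * cis (- (x n * sqrt (k n) * \<theta>))) = (LINT y|lborel. G n y)"
    if "k n > 0" for n
  proof -
    have "(LINT \<theta>:{-pi..pi}|lborel. \<psi> \<theta> ^ k n * cis (- (x n * sqrt (k n) * \<theta>)))
      = \<bar>1 / sqrt (k n)\<bar> *\<^sub>R (LINT y|lborel. indicator {-pi..pi} (0 + 1 / sqrt (k n) * y) *\<^sub>R (\<psi> (0 + 1 / sqrt (k n) * y) ^ k n * cis (- (x n * sqrt (k n) * (0 + 1 / sqrt (k n) * y)))))"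
      unfolding set_lebesgue_integral_def using that by (intro lborel_integral_real_affine) auto
    then show ?thesis using that by (simp add: G_def)
  qed
  have "(\<lambda>n. LINT y|lborel. G n y) \<longlonglongrightarrow> (LINT y|lborel. exp (- (v * y\<^sup>2 / 2)) *\<^sub>R cis (- \<xi> * y))"
  proof (rule integral_dominated_convergence[where w = "\<lambda>y. exp (- c * y\<^sup>2)"])
    show "integrable lborel (\<lambda>y. exp (- c * y\<^sup>2))" by (rule integrable_gaussian[OF c])
    show "G n \<in> borel_measurable lborel" for n unfolding G_def by measurable
    show "AE y in lborel. norm (G n y) \<le> exp (- c * y\<^sup>2)" for n
    proof (rule AE_I2)
      fix y
      show "norm (G n y) \<le> exp (- c * y\<^sup>2)"
      proof (cases "k n > 0 \<and> \<bar>y / sqrt (k n)\<bar> \<le> pi")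
        case True
        then have "norm (G n y) \<le> norm (\<psi> (y / sqrt (k n))) ^ k n"
          by (auto simp: G_def norm_mult norm_power indicator_def)
        also have "\<dots> \<le> exp (- c * (y / sqrt (k n))\<^sup>2) ^ k n"
          using True by (intro power_mono dom) auto
        also have "\<dots> = exp (- c * y\<^sup>2)"
          using True by (simp add: exp_of_nat_mult[symmetric] power_divide)
        finally show ?thesis .
      qed (auto simp: G_def indicator_def abs_le_iff)
    qed
    show "AE y in lborel. (\<lambda>n. G n y) \<longlonglongrightarrow> exp (- (v * y\<^sup>2 / 2)) *\<^sub>R cis (- \<xi> * y)"
    proof (rule AE_I2)
      fix y
      define s where "s n = y / sqrt (k n)" for n
      have s0: "s \<longlonglongrightarrow> 0" unfolding s_def
        by (intro tendsto_divide_0[OF tendsto_const] filterlim_at_top_imp_at_infinity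
            filterlim_compose[OF sqrt_at_top kr])
      have small: "eventually (\<lambda>n. \<bar>s n\<bar> < pi) sequentially"
        using tendstoD[OF s0, of pi] by simp
      have "(\<lambda>n. \<psi> (s n) ^ k n - exp (- (v * y\<^sup>2 / 2))) \<longlonglongrightarrow> 0"
      proof (cases "y = 0")
        case True
        \<comment> \<open>Here s is constantly 0, and \<open>loc\<close>, a limit at the punctured
          point, says nothing directly about \<psi> 0. Continuity forces \<psi> 0 = 1.\<close>
        have "((\<lambda>\<theta>. (\<psi> \<theta> - exp (- (v * \<theta>\<^sup>2 / 2))) / \<theta>\<^sup>2 * \<theta>\<^sup>2) \<longlongrightarrow> 0 * of_real (0\<^sup>2)) (at 0)"
          by (rule tendsto_mult[OF loc]) (auto intro!: tendsto_eq_intros)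
        moreover have "eventually (\<lambda>\<theta>. (\<psi> \<theta> - exp (- (v * \<theta>\<^sup>2 / 2))) / \<theta>\<^sup>2 * \<theta>\<^sup>2 = \<psi> \<theta> - exp (- (v * \<theta>\<^sup>2 / 2))) (at 0)"
          by (auto simp: eventually_at_filter)
        ultimately have "((\<lambda>\<theta>. \<psi> \<theta> - exp (- (v * \<theta>\<^sup>2 / 2))) \<longlongrightarrow> 0) (at 0)"
          using tendsto_cong by fastforce
        moreover have "((\<lambda>\<theta>. \<psi> \<theta> - exp (- (v * \<theta>\<^sup>2 / 2))) \<longlongrightarrow> \<psi> 0 - of_real (exp (- (v * 0\<^sup>2 / 2)))) (at 0)"
          using cont by (intro tendsto_intros) (auto simp: continuous_on_def)
        ultimately have "\<psi> 0 = 1"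
          using LIM_unique[of "\<lambda>\<theta>. \<psi> \<theta> - exp (- (v * \<theta>\<^sup>2 / 2))" 0 0 "\<psi> 0 - 1"] by auto
        then show ?thesis using True by (simp add: s_def)
      next
        case False
        have sat: "filterlim s (at 0) sequentially"
          using s0 kpos False by (auto simp: filterlim_at s_def elim!: eventually_mono)
        have lim: "(\<lambda>n. y\<^sup>2 * norm ((\<psi> (s n) - exp (- (v * (s n)\<^sup>2 / 2))) / (s n)\<^sup>2)) \<longlonglongrightarrow> 0"
          by (intro tendsto_mult_right_zero tendsto_norm_zero filterlim_compose[OF loc sat])
        show ?thesis
        proof (rule Lim_null_comparison[OF _ lim])
          show "eventually (\<lambda>n. norm (\<psi> (s n) ^ k n - exp (- (v * y\<^sup>2 / 2))) \<le>
              y\<^sup>2 * norm ((\<psi> (s n) - exp (- (v * (s n)\<^sup>2 / 2))) / (s n)\<^sup>2)) sequentially"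
            using small kpos
          proof eventually_elim
            case (elim n)
            \<comment> \<open>Numbers of norm at most 1 satisfy |a^k - b^k| \<le> k |a - b|. Written
              as y^2 / s^2, the factor k is exactly what the o(s^2) of \<open>loc\<close> can
              absorb.\<close>
            have ks: "k n = y\<^sup>2 / (s n)\<^sup>2" using elim False by (simp add: s_def power_divide)
            have "complex_of_real (exp (- (v * y\<^sup>2 / 2))) = complex_of_real (exp (- (v * (s n)\<^sup>2 / 2))) ^ k n"
              using elim by (simp add: of_real_power[symmetric] exp_of_nat_mult[symmetric] s_def power_divide
                  del: of_real_power)
            also have "norm (\<psi> (s n) ^ k n - \<dots>) \<le> k n * norm (\<psi> (s n) - exp (- (v * (s n)\<^sup>2 / 2)))"
            proof (rule norm_power_diff)
              have "norm (\<psi> (s n)) \<le> exp (- c * (s n)\<^sup>2)" using elim by (intro dom) auto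
              also have "\<dots> \<le> 1" using c by simp
              finally show "norm (\<psi> (s n)) \<le> 1" .
              show "norm (complex_of_real (exp (- (v * (s n)\<^sup>2 / 2)))) \<le> 1"
                using v by simp
            qed
            also have "\<dots> = y\<^sup>2 * norm ((\<psi> (s n) - exp (- (v * (s n)\<^sup>2 / 2))) / (s n)\<^sup>2)"
              unfolding ks by (simp add: norm_divide norm_power)
            finally show ?case .
          qed
        qed
      qed
      then have "(\<lambda>n. \<psi> (s n) ^ k n) \<longlonglongrightarrow> exp (- (v * y\<^sup>2 / 2))"
        by (simp add: LIM_zero_iff)
      moreover have "(\<lambda>n. cis (- (x n * y))) \<longlonglongrightarrow> cis (- (\<xi> * y))"
        unfolding cis_conv_exp by (intro tendsto_intros x)
      ultimately have "(\<lambda>n. \<psi> (s n) ^ k n * cis (- (x n * y))) \<longlonglongrightarrow> exp (- (v * y\<^sup>2 / 2)) * cis (- (\<xi> * y))"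
        by (rule tendsto_mult)
      moreover have "eventually (\<lambda>n. \<psi> (s n) ^ k n * cis (- (x n * y)) = G n y) sequentially"
        using small kpos
      proof eventually_elim
        case (elim n)
        then have "s n \<in> {-pi..pi}" by auto
        then show ?case using elim by (simp add: G_def s_def)
      qed
      ultimately show "(\<lambda>n. G n y) \<longlonglongrightarrow> exp (- (v * y\<^sup>2 / 2)) *\<^sub>R cis (- \<xi> * y)"
        by (auto simp: scaleR_conv_of_real intro: Lim_transform_eventually)
    qed
  qed (auto)
  also have "(LINT y|lborel. exp (- (v * y\<^sup>2 / 2)) *\<^sub>R cis (- \<xi> * y)) = complex_of_real (sqrt (2 * pi / v) * exp (- \<xi>\<^sup>2 / (2 * v)))"
    by (rule integral_gaussian_cis[OF v])
  finally show ?thesis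
    by (rule Lim_transform_eventually) (use kpos eq in \<open>auto elim!: eventually_mono\<close>)
qed

text \<open>Near 0 the second derivative has norm below e / 2, so Taylor's formula bounds f by a
  small multiple of \<theta>^2. Entire functions are used so that complex Taylor applies without
  splitting into real and imaginary parts.\<close>

lemma second_order_vanishing:
  fixes f f1 f2 :: "complex \<Rightarrow> complex"
  assumes f1: "\<And>z. (f has_field_derivative f1 z) (at z)"
    and f2: "\<And>z. (f1 has_field_derivative f2 z) (at z)"
    and cont: "isCont f2 0" and z: "f 0 = 0" "f1 0 = 0" "f2 0 = 0"
  shows "((\<lambda>\<theta>. f (of_real \<theta>) / of_real (\<theta>\<^sup>2)) \<longlongrightarrow> 0) (at (0::real))"
proof (rule tendstoI)
  fix e :: real assume e: "e > 0"
  have "e/2 > 0" using e by simp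
  then obtain d where d: "d > 0" "\<And>w. norm w < d \<Longrightarrow> norm (f2 w) < e/2"
    using cont[unfolded continuous_at_eps_delta, rule_format, of "e/2"] z by (auto simp: dist_norm)
  have "dist (f (of_real \<theta>) / of_real (\<theta>\<^sup>2)) 0 < e" if t: "\<theta> \<noteq> 0" "\<bar>\<theta>\<bar> < d" for \<theta> :: real
  proof -
    define F where "F = (\<lambda>i::nat. if i = 0 then f else if i = 1 then f1 else f2)"
    have "norm (F 0 (of_real \<theta>) - (\<Sum>i\<le>1. F i 0 * (of_real \<theta> - 0) ^ i / fact i))
        \<le> e/2 * norm (of_real \<theta> - 0 :: complex) ^ Suc 1 / fact 1"
    proof (rule complex_Taylor[where S="ball 0 d"])
      show "convex (ball (0::complex) d)" "0 \<in> ball (0::complex) d" "complex_of_real \<theta> \<in> ball 0 d"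
        using t d by auto
      show "(F i has_field_derivative F (Suc i) x) (at x within ball 0 d)" if "i \<le> 1" for i x
        using that f1 f2 by (cases i) (auto simp: F_def intro: has_field_derivative_at_within)
      show "norm (F (Suc 1) x) \<le> e/2" if "x \<in> ball 0 d" for x
        using d(2)[of x] that by (simp add: F_def)
    qed
    then have "norm (f (of_real \<theta>)) \<le> e/2 * \<theta>\<^sup>2"
      using z by (simp add: F_def power2_eq_square)
    also have "\<dots> < e * \<theta>\<^sup>2" using e t by simp
    finally show ?thesis using t by (simp add: norm_divide norm_power divide_simps)
  qed
  then show "\<forall>\<^sub>F \<theta> in at (0::real). dist (f (of_real \<theta>) / of_real (\<theta>\<^sup>2)) 0 < e"
    unfolding eventually_at using d(1) by (auto simp: dist_norm)
qed

text \<open>The Gaussian exp (-v z^2 / 2) agrees with f at 0 up to the second derivative, so the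
  difference falls under \<open>second_order_vanishing\<close>. The condition on \<open>f1 0\<close>
  is the reason for recentring characteristic functions.\<close>

lemma gaussian_expansion:
  fixes f f1 f2 :: "complex \<Rightarrow> complex" and v :: real
  assumes f1: "\<And>z. (f has_field_derivative f1 z) (at z)"
    and f2: "\<And>z. (f1 has_field_derivative f2 z) (at z)"
    and cont: "isCont f2 0" and z: "f 0 = 1" "f1 0 = 0" "f2 0 = - of_real v"
  shows "((\<lambda>\<theta>. (f (of_real \<theta>) - exp (- (v * \<theta>\<^sup>2 / 2))) / of_real (\<theta>\<^sup>2)) \<longlongrightarrow> 0) (at (0::real))"
proof -
  define g where "g z = exp (- (of_real (v / 2) * z\<^sup>2))" for z :: complex
  have "((\<lambda>\<theta>. (f (of_real \<theta>) - g (of_real \<theta>)) / of_real (\<theta>\<^sup>2)) \<longlongrightarrow> 0) (at (0::real))"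
  proof (rule second_order_vanishing[where f = "\<lambda>z. f z - g z"
        and ?f1.0 = "\<lambda>z. f1 z + of_real v * z * g z"
        and ?f2.0 = "\<lambda>z. f2 z + (of_real v - (of_real v)\<^sup>2 * z\<^sup>2) * g z"])
    show "((\<lambda>z. f z - g z) has_field_derivative f1 z + of_real v * z * g z) (at z)" for z
      unfolding g_def by (auto intro!: derivative_eq_intros f1)
    show "((\<lambda>z. f1 z + of_real v * z * g z) has_field_derivative f2 z + (of_real v - (of_real v)\<^sup>2 * z\<^sup>2) * g z) (at z)" for z
      unfolding g_def by (auto intro!: derivative_eq_intros f2 simp: algebra_simps power2_eq_square)
    show "isCont (\<lambda>z. f2 z + (of_real v - (of_real v)\<^sup>2 * z\<^sup>2) * g z) 0"
      unfolding g_def by (intro continuous_intros cont)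
  qed (use z in \<open>auto simp: g_def\<close>)
  then show ?thesis by (simp add: g_def exp_of_real[symmetric])
qed

section \<open>Fourier coefficients of the exponential and Stirling's formula\<close>

lemma higher_deriv_exp_linear: "(deriv ^^ m) (\<lambda>z::complex. exp (a * z)) = (\<lambda>z. a ^ m * exp (a * z))"
proof (induction m)
  case (Suc m)
  have "deriv (\<lambda>z. a ^ m * exp (a * z)) z = a ^ Suc m * exp (a * z)" for z
    by (rule DERIV_imp_deriv) (rule derivative_eq_intros refl | simp)+
  then show ?case by (simp add: Suc.IH)
qed auto

lemma fourier_coeff_exp:
  fixes a :: complex
  shows "(LINT \<theta>:{-pi..pi}|lborel. exp (a * cis \<theta>) * cis (- (real m * \<theta>))) = 2 * pi * a ^ m / fact m"
proof -
  \<comment> \<open>Cauchy's formula integrates over \<open>[0, 2\<pi>]\<close>; shifting by \<open>\<pi>\<close> turns \<open>cis\<close> into \<open>-cis\<close>, which replacing \<open>a\<close> by \<open>-a\<close> undoes.\<close>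
  have "((\<lambda>u. exp (- a * u) / (u - 0) ^ Suc m) has_contour_integral
      (2 * pi * \<i> / fact m * (deriv ^^ m) (\<lambda>z. exp (- a * z)) 0)) (circlepath 0 1)"
    by (intro Cauchy_has_contour_integral_higher_derivative_circlepath continuous_intros holomorphic_intros) auto
  then have "((\<lambda>t. exp (- a * cis t) / cis t ^ Suc m * \<i> * cis t) has_integral (2 * pi * \<i> / fact m * (- a) ^ m)) {0..2*pi}"
    unfolding higher_deriv_exp_linear circlepath_def
    by (subst (asm) has_contour_integral_part_circlepath_iff) auto
  from has_integral_shift_real_ivl[OF this, of pi]
  have "((\<lambda>t. exp (- a * cis (t + pi)) / cis (t + pi) ^ Suc m * \<i> * cis (t + pi)) has_integral (2 * pi * \<i> / fact m * (- a) ^ m)) {-pi..pi}"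
    by simp
  then have "((\<lambda>t. (- 1) ^ m * (- \<i>) * (exp (- a * cis (t + pi)) / cis (t + pi) ^ Suc m * \<i> * cis (t + pi)))
     has_integral ((- 1) ^ m * (- \<i>) * (2 * pi * \<i> / fact m * (- a) ^ m))) {-pi..pi}"
    by (rule has_integral_mult_right)
  moreover have "(- 1) ^ m * (- \<i>) * (exp (- a * cis (t + pi)) / cis (t + pi) ^ Suc m * \<i> * cis (t + pi)) = exp (a * cis t) * cis (- (real m * t))" for t
  proof -
    have "cis (t + pi) = - cis t" by (simp add: cis_mult[symmetric])
    moreover have "cis (- (real m * t)) = 1 / cis t ^ m"
      by (simp only: Complex.DeMoivre cis_inverse[symmetric] inverse_eq_divide)
    ultimately show ?thesis by (cases "even m") (simp_all add: field_simps)
  qed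
  moreover have "(- 1) ^ m * (- \<i>) * (2 * pi * \<i> / fact m * (- a) ^ m) = 2 * pi * a ^ m / fact m"
    by (cases "even m") (simp_all add: field_simps)
  ultimately have "integral {-pi..pi} (\<lambda>t. exp (a * cis t) * cis (- (real m * t))) = 2 * pi * a ^ m / fact m"
    by (simp add: integral_unique)
  moreover have "set_integrable lborel {-pi..pi} (\<lambda>t. exp (a * cis t) * cis (- (real m * t)))"
    by (intro borel_integrable_atLeastAtMost' continuous_intros)
  ultimately show ?thesis by (simp add: set_borel_integral_eq_integral)
qed

text \<open>1 - cos \<theta> = 2 sin^2 (\<theta> / 2). With y = |\<theta>| / 2, pi < 4 gives y \<le>
  2, where sin y \<ge> y - y^3 / 6 \<ge> y / 3; hence 2 (\<theta> / 6)^2 = \<theta>^2 / 18. Only the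
  positivity of the constant matters.\<close>

lemma one_minus_cos_ge:
  assumes "\<bar>\<theta>\<bar> \<le> pi" shows "1 - cos \<theta> \<ge> \<theta>\<^sup>2 / 18"
proof -
  define y where "y = \<bar>\<theta>\<bar> / 2"
  have y: "0 \<le> y" "y \<le> 2" using assms pi_less_4 by (auto simp: y_def)
  have "\<bar>sin y - (\<Sum>m<3. sin_coeff m * y ^ m)\<bar> \<le> inverse (fact 3) * \<bar>y\<bar> ^ 3"
    by (rule Maclaurin_sin_bound)
  then have "sin y \<ge> y - y ^ 3 / 6"
    using y by (simp add: sin_coeff_def eval_nat_numeral abs_if split: if_splits)
  moreover have "y ^ 3 \<le> 4 * y"
    using y mult_mono[of y 2 y 2] mult_right_mono[of "y * y" 4 y] by (simp add: power3_eq_cube)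
  ultimately have "sin y \<ge> y / 3" by simp
  then have "(y / 3)\<^sup>2 \<le> (sin y)\<^sup>2" using y by (intro power_mono) auto
  moreover have "1 - cos \<theta> = 2 * (sin y)\<^sup>2"
    using cos_double_sin[of y] by (simp add: y_def)
  ultimately show ?thesis by (simp add: y_def power_divide)
qed

text \<open>The function \<open>f\<close> is the characteristic function of X - 1 for a Poisson
  variable X of mean 1. Its n-th power belongs to a Poisson variable of mean n, recentred, so the
  integral at frequency 0 is 2 pi times the probability n^n exp (-n) / n! of hitting the mean. The
  variance is 1.\<close>

lemma stirling:
  "(\<lambda>k. sqrt (real k) * real k ^ k * exp (- real k) / fact k) \<longlonglongrightarrow> 1 / sqrt (2 * pi)"
proof -
  define f where "f z = exp (exp (\<i> * z) - 1 - \<i> * z)" for z :: complex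
  define \<psi> where "\<psi> \<theta> = f (of_real \<theta>)" for \<theta> :: real
  have *: "(\<lambda>n. sqrt (real n) *\<^sub>R (LINT \<theta>:{-pi..pi}|lborel. \<psi> \<theta> ^ n * cis (- (0 * sqrt (real n) * \<theta>))))
      \<longlonglongrightarrow> complex_of_real (sqrt (2 * pi / 1) * exp (- 0\<^sup>2 / (2 * 1)))"
  proof (rule fourier_local_limit[where c = "1/18"])
    show "continuous_on UNIV \<psi>" unfolding \<psi>_def f_def by (intro continuous_intros)
    show "filterlim (\<lambda>n. n) at_top sequentially" by (rule filterlim_ident)
    show "norm (\<psi> \<theta>) \<le> exp (- (1/18) * \<theta>\<^sup>2)" if "\<bar>\<theta>\<bar> \<le> pi" for \<theta>
    proof -
      have "norm (\<psi> \<theta>) = exp (cos \<theta> - 1)"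
        by (simp add: \<psi>_def f_def norm_exp_eq_Re flip: cis_conv_exp)
      then show ?thesis using one_minus_cos_ge[OF that] by simp
    qed
    show "((\<lambda>\<theta>. (\<psi> \<theta> - exp (- (1 * \<theta>\<^sup>2 / 2))) / of_real (\<theta>\<^sup>2)) \<longlongrightarrow> 0) (at 0)"
      unfolding \<psi>_def
    proof (rule gaussian_expansion)
      show "(f has_field_derivative (\<i> * (exp (\<i> * z) - 1)) * f z) (at z)" for z
        unfolding f_def by (rule derivative_eq_intros refl | simp)+ (simp add: algebra_simps)
      then show "((\<lambda>z. (\<i> * (exp (\<i> * z) - 1)) * f z) has_field_derivative
          - exp (\<i> * z) * f z - (exp (\<i> * z) - 1)\<^sup>2 * f z) (at z)" for z
        by (auto intro!: derivative_eq_intros simp: algebra_simps power2_eq_square)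
    qed (auto simp: f_def intro!: continuous_intros)
  qed auto
  have "(LINT \<theta>:{-pi..pi}|lborel. \<psi> \<theta> ^ n * cis (- (0 * sqrt (real n) * \<theta>))) = complex_of_real (2 * pi * real n ^ n * exp (- real n) / fact n)" for n
  proof -
    have "\<psi> \<theta> ^ n * cis (- (0 * sqrt (real n) * \<theta>)) = exp (- real n) * (exp (of_nat n * cis \<theta>) * cis (- (real n * \<theta>)))" for \<theta>
      by (simp add: \<psi>_def f_def cis_conv_exp mult_ac exp_of_real[symmetric] flip: exp_of_nat_mult exp_add)
         (simp add: algebra_simps)
    then have "(LINT \<theta>:{-pi..pi}|lborel. \<psi> \<theta> ^ n * cis (- (0 * sqrt (real n) * \<theta>)))
      = (LINT \<theta>:{-pi..pi}|lborel. exp (- real n) * (exp (of_nat n * cis \<theta>) * cis (- (real n * \<theta>))))"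
      by (simp only:)
    also have "\<dots> = complex_of_real (2 * pi * real n ^ n * exp (- real n) / fact n)"
      unfolding set_integral_mult_right fourier_coeff_exp by simp
    finally show ?thesis .
  qed
  then have "(\<lambda>n. complex_of_real (2 * pi * (sqrt (real n) * real n ^ n * exp (- real n) / fact n))) \<longlonglongrightarrow> complex_of_real (sqrt (2 * pi))"
    using * by (simp add: scaleR_conv_of_real mult_ac)
  then have "(\<lambda>n. 2 * pi * (sqrt (real n) * real n ^ n * exp (- real n) / fact n)) \<longlonglongrightarrow> sqrt (2 * pi)"
    by (simp only: tendsto_of_real_iff)
  then have "(\<lambda>n. 1 / (2 * pi) * (2 * pi * (sqrt (real n) * real n ^ n * exp (- real n) / fact n))) \<longlonglongrightarrow> 1 / (2 * pi) * sqrt (2 * pi)"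
    by (rule tendsto_mult_left)
  moreover have "1 / (2 * pi) * sqrt (2 * pi) = 1 / sqrt (2 * pi)"
    by (simp add: divide_simps)
  ultimately show ?thesis by simp
qed

section \<open>Fourier coefficients of surjection numbers\<close>

text \<open>Write z for r cis \<theta>. Nonnegative power series coefficients give exp r - 1 as a
  bound at once; the quadratic gain comes from the first two terms alone, z (1 + z / 2), since 1 + z
  / 2 is strictly shorter than 1 + r / 2 off the real axis. The terms from z^3 on are bounded by
  their values at r.\<close>

lemma norm_exp_minus_one_le:
  fixes \<theta> r :: real assumes "r > 0" "\<bar>\<theta>\<bar> \<le> pi"
  shows "norm (exp (r * cis \<theta>) - 1) \<le> exp r - 1 - r\<^sup>2 * \<theta>\<^sup>2 / (18 * (2 + r))"
proof -
  define z where "z = r * cis \<theta>"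
  have nz: "norm z = r" using assms by (simp add: z_def norm_mult)
  have S: "(\<lambda>n. z ^ (n + 3) /\<^sub>R fact (n + 3)) sums (exp z - (\<Sum>n<3. z ^ n /\<^sub>R fact n))"
    using sums_iff_shift[of "\<lambda>n. z ^ n /\<^sub>R fact n" 3] exp_converges[of z] by simp
  have Sr: "(\<lambda>n. r ^ (n + 3) /\<^sub>R fact (n + 3)) sums (exp r - (\<Sum>n<3. r ^ n /\<^sub>R fact n))"
    using sums_iff_shift[of "\<lambda>n. r ^ n /\<^sub>R fact n" 3] exp_converges[of r] by simp
  have nt: "norm (z ^ (n + 3) /\<^sub>R fact (n + 3)) = r ^ (n + 3) /\<^sub>R fact (n + 3)" for n
    by (simp only: norm_scaleR norm_power nz) simp
  have "norm (\<Sum>n. z ^ (n + 3) /\<^sub>R fact (n + 3)) \<le> (\<Sum>n. norm (z ^ (n + 3) /\<^sub>R fact (n + 3)))"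
    by (rule summable_norm) (simp only: nt sums_summable[OF Sr])
  then have rest: "norm (exp z - (\<Sum>n<3. z ^ n /\<^sub>R fact n)) \<le> exp r - (\<Sum>n<3. r ^ n /\<^sub>R fact n)"
    unfolding nt using S Sr by (simp add: sums_iff)
  define t where "t = 1 - cos \<theta>"
  have t: "t \<ge> \<theta>\<^sup>2 / 18" "t \<le> 2" using one_minus_cos_ge[OF assms(2)] by (auto simp: t_def)
  have "(norm (1 + z / 2))\<^sup>2 = (1 + r / 2 * cos \<theta>)\<^sup>2 + (r / 2 * sin \<theta>)\<^sup>2"
    by (simp add: cmod_power2 z_def)
  also have "\<dots> = (1 + r / 2)\<^sup>2 - r * t"
    by (simp add: power2_sum power_mult_distrib power_divide cos_squared_eq t_def field_simps)
  \<comment> \<open>Completing the square by w = r t / (2 + r), which makes the bound on the norm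
    linear in t = 1 - cos \<theta>.\<close>
  also have "\<dots> \<le> (1 + r / 2 - r * t / (2 + r))\<^sup>2"
  proof -
    define w where "w = r * t / (2 + r)"
    have "r * t = w * (2 + r)" using assms by (simp add: w_def)
    then have "(1 + r / 2 - w)\<^sup>2 = (1 + r / 2)\<^sup>2 - r * t + w\<^sup>2"
      by (simp add: power2_eq_square algebra_simps)
    then show ?thesis by (simp add: w_def)
  qed
  finally have "norm (1 + z / 2) \<le> 1 + r / 2 - r * t / (2 + r)"
  proof (rule power2_le_imp_le)
    have "r * t \<le> 2 * r" using assms t by simp
    also have "(1 + r / 2) * (2 + r) = 2 * r + (2 + r\<^sup>2 / 2)" by (simp add: algebra_simps power2_eq_square)
    then have "2 * r \<le> (1 + r / 2) * (2 + r)" by simp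
    finally show "0 \<le> 1 + r / 2 - r * t / (2 + r)" using assms by (simp add: divide_le_eq)
  qed
  then have "r * norm (1 + z / 2) \<le> r * (1 + r / 2 - r * t / (2 + r))"
    using assms by (intro mult_left_mono) auto
  then have "norm (z * (1 + z / 2)) \<le> r + r\<^sup>2 / 2 - r\<^sup>2 * t / (2 + r)"
    unfolding norm_mult nz by (simp add: algebra_simps power2_eq_square)
  moreover have "r\<^sup>2 * (\<theta>\<^sup>2 / 18) / (2 + r) \<le> r\<^sup>2 * t / (2 + r)"
    using assms t by (intro divide_right_mono mult_left_mono) auto
  ultimately have "norm (z * (1 + z / 2)) \<le> r + r\<^sup>2 / 2 - r\<^sup>2 * \<theta>\<^sup>2 / (18 * (2 + r))"
    by (simp add: mult.commute)
  moreover have "exp z - 1 = z * (1 + z / 2) + (exp z - (\<Sum>n<3. z ^ n /\<^sub>R fact n))"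
    by (simp add: eval_nat_numeral scaleR_conv_of_real algebra_simps)
  then have "norm (exp z - 1) \<le> norm (z * (1 + z / 2)) + norm (exp z - (\<Sum>n<3. z ^ n /\<^sub>R fact n))"
    using norm_triangle_ineq by metis
  moreover have "(\<Sum>n<3. r ^ n /\<^sub>R fact n) = 1 + r + r\<^sup>2 / 2"
    by (simp add: eval_nat_numeral)
  ultimately show ?thesis using rest by (simp add: z_def)
qed

text \<open>Cauchy's integral for the coefficient of z^m in (exp (ln 2 * z) - 1)^k. All the analysis
  is done for this integral; only \<open>card_surjections_fourier\<close> identifies it with a
  count.\<close>

definition surj_coeff :: "nat \<Rightarrow> nat \<Rightarrow> complex" where
  "surj_coeff k m = (LINT \<theta>:{-pi..pi}|lborel. (exp (ln 2 * cis \<theta>) - 1) ^ k * cis (- (real m * \<theta>))) / (2 * pi)"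

text \<open>Expanding ((exp (ln 2 * z) - 1) + 1)^k by the binomial theorem and taking coefficients.
  This is the analytic twin of sorting all maps from m into k elements by their image, and it
  determines the coefficients recursively in k.\<close>

lemma surj_coeff_binomial:
  "(\<Sum>j\<le>k. of_nat (k choose j) * surj_coeff j m) = (of_nat k * ln 2) ^ m / fact m"
proof -
  define I where "I j \<theta> = (exp (ln 2 * cis \<theta>) - 1 :: complex) ^ j * cis (- (real m * \<theta>))" for j \<theta>
  have int: "set_integrable lborel {-pi..pi} (\<lambda>\<theta>. of_nat (k choose j) * I j \<theta>)" for j
    unfolding I_def by (intro borel_integrable_atLeastAtMost' continuous_intros)
  have "(\<Sum>j\<le>k. of_nat (k choose j) * surj_coeff j m) = (\<Sum>j\<le>k. (LINT \<theta>:{-pi..pi}|lborel. of_nat (k choose j) * I j \<theta>)) / (2 * pi)"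
    by (simp add: surj_coeff_def I_def sum_divide_distrib)
  also have "(\<Sum>j\<le>k. (LINT \<theta>:{-pi..pi}|lborel. of_nat (k choose j) * I j \<theta>))
     = (LINT \<theta>:{-pi..pi}|lborel. (\<Sum>j\<le>k. of_nat (k choose j) * I j \<theta>))"
    using int unfolding set_lebesgue_integral_def set_integrable_def
    by (subst scaleR_sum_right, subst Bochner_Integration.integral_sum) auto
  also have "(\<lambda>\<theta>. (\<Sum>j\<le>k. of_nat (k choose j) * I j \<theta>)) = (\<lambda>\<theta>. exp ((of_nat k * ln 2) * cis \<theta>) * cis (- (real m * \<theta>)))"
  proof
    fix \<theta>
    have "(\<Sum>j\<le>k. of_nat (k choose j) * I j \<theta>) = (\<Sum>j\<le>k. of_nat (k choose j) * (exp (ln 2 * cis \<theta>) - 1) ^ j * 1 ^ (k - j)) * cis (- (real m * \<theta>))"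
      unfolding I_def sum_distrib_right by (intro sum.cong) (simp_all add: mult_ac)
    also have "(\<Sum>j\<le>k. of_nat (k choose j) * (exp (ln 2 * cis \<theta>) - 1) ^ j * 1 ^ (k - j)) = exp (ln 2 * cis \<theta>) ^ k"
      by (subst binomial_ring[symmetric]) simp
    finally show "(\<Sum>j\<le>k. of_nat (k choose j) * I j \<theta>) = exp ((of_nat k * ln 2) * cis \<theta>) * cis (- (real m * \<theta>))"
      by (simp add: exp_of_nat_mult[symmetric] mult_ac)
  qed
  also have "(LINT \<theta>:{-pi..pi}|lborel. exp ((of_nat k * ln 2) * cis \<theta>) * cis (- (real m * \<theta>))) / (2 * pi) = (of_nat k * ln 2) ^ m / fact m"
    using fourier_coeff_exp[of "of_nat k * ln 2" m] by simp
  finally show ?thesis .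
qed

text \<open>
  \<open>exp (ln 2 * cis \<theta>) - 1\<close> is the characteristic function of the Poisson distribution with
  parameter \<open>ln 2\<close> conditioned to be nonzero, whose mean is \<open>2 * ln 2\<close> and whose variance
  is \<open>2 * ln 2 * (1 - ln 2)\<close>; \<open>Psi\<close> is the recentred version, extended to complex arguments.
\<close>
definition Psi :: "complex \<Rightarrow> complex" where
  "Psi z = exp (ln 2 * exp (\<i> * z) - \<i> * (2 * ln 2) * z) - exp (- (\<i> * (2 * ln 2) * z))"
definition Psi1 :: "complex \<Rightarrow> complex" where
  "Psi1 z = (\<i> * ln 2 * exp (\<i> * z) - \<i> * (2 * ln 2)) * exp (ln 2 * exp (\<i> * z) - \<i> * (2 * ln 2) * z)
     + \<i> * (2 * ln 2) * exp (- (\<i> * (2 * ln 2) * z))"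
definition Psi2 :: "complex \<Rightarrow> complex" where
  "Psi2 z = (- ln 2 * exp (\<i> * z) - (ln 2 * exp (\<i> * z) - 2 * ln 2)\<^sup>2) * exp (ln 2 * exp (\<i> * z) - \<i> * (2 * ln 2) * z)
     + (2 * ln 2)\<^sup>2 * exp (- (\<i> * (2 * ln 2) * z))"

lemma Psi_deriv: "(Psi has_field_derivative Psi1 z) (at z)" "(Psi1 has_field_derivative Psi2 z) (at z)"
  unfolding Psi_def[abs_def] Psi1_def[abs_def] Psi2_def
  by (rule derivative_eq_intros refl | simp)+ (simp add: algebra_simps power2_eq_square)+

lemma isCont_Psi2: "isCont Psi2 z"
  unfolding Psi2_def[abs_def] by (intro continuous_intros)

lemma Psi_0: "Psi 0 = 1" "Psi1 0 = 0" "Psi2 0 = - of_real (2 * ln 2 * (1 - ln 2))"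
proof -
  have l: "(ln 2 :: complex) = of_real (ln 2)" using Ln_of_real[of 2] by simp
  have e: "exp (complex_of_real (ln 2)) = 2" by (simp add: exp_of_real)
  show "Psi 0 = 1" "Psi1 0 = 0" "Psi2 0 = - of_real (2 * ln 2 * (1 - ln 2))"
    unfolding Psi_def Psi1_def Psi2_def
    by (simp_all add: l e algebra_simps power2_eq_square)
qed

lemma Psi_gaussian:
  "((\<lambda>\<theta>. (Psi (of_real \<theta>) - exp (- (2 * ln 2 * (1 - ln 2) * \<theta>\<^sup>2 / 2))) / of_real (\<theta>\<^sup>2)) \<longlongrightarrow> 0) (at (0::real))"
  by (rule gaussian_expansion[OF Psi_deriv isCont_Psi2 Psi_0])

lemma continuous_Psi [continuous_intros]:
  "continuous_on S f \<Longrightarrow> continuous_on S (\<lambda>x. Psi (f x))"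
  "continuous_on S f \<Longrightarrow> continuous_on S (\<lambda>x. Psi1 (f x))"
  unfolding Psi_def Psi1_def by (intro continuous_intros; assumption)+

text \<open>Recentring moves the mean 2 k ln 2 into the frequency, which becomes the deviation of m
  from it. \<open>Psi\<close> alone is not 2 pi periodic, since 2 ln 2 is no integer, but the
  left-hand side is; integration by parts will need that.\<close>

lemma Psi_conv:
  "(exp (ln 2 * cis \<theta>) - 1) ^ k * cis (- (real m * \<theta>)) = Psi (of_real \<theta>) ^ k * cis (- ((real m - 2 * ln 2 * real k) * \<theta>))"
proof -
  have l: "(ln 2 :: complex) = of_real (ln 2)" using Ln_of_real[of 2] by simp
  have "Psi (of_real \<theta>) = (exp (ln 2 * cis \<theta>) - 1) * cis (- (2 * ln 2 * \<theta>))"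
    by (simp add: Psi_def cis_conv_exp algebra_simps l exp_diff exp_minus field_simps)
  then have "Psi (of_real \<theta>) ^ k = (exp (ln 2 * cis \<theta>) - 1) ^ k * cis (- (2 * ln 2 * real k * \<theta>))"
    by (simp add: power_mult_distrib Complex.DeMoivre mult_ac)
  then show ?thesis by (simp add: cis_mult algebra_simps)
qed

text \<open>As exp (ln 2) - 1 = 1, \<open>norm_exp_minus_one_le\<close> reads 1 - c \<theta>^2,
  which is at most exp (-c \<theta>^2).\<close>

lemma Psi_norm_le:
  "\<exists>c>0. \<forall>\<theta>. \<bar>\<theta>\<bar> \<le> pi \<longrightarrow> norm (Psi (of_real \<theta>)) \<le> exp (- c * \<theta>\<^sup>2)"
proof -
  define c where "c = (ln 2)\<^sup>2 / (18 * (2 + ln 2 :: real))"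
  have ln2: "ln (2::real) > 0" by simp
  have c: "c > 0" unfolding c_def using ln2 by (intro divide_pos_pos) (auto intro: add_pos_pos)
  have le: "norm (Psi (of_real \<theta>)) \<le> exp (- c * \<theta>\<^sup>2)" if t: "\<bar>\<theta>\<bar> \<le> pi" for \<theta>
  proof -
    have l: "(ln 2 :: complex) = of_real (ln 2)" using Ln_of_real[of 2] by simp
    have "norm (Psi (of_real \<theta>)) = norm (exp (complex_of_real (ln 2) * cis \<theta>) - 1)"
      using Psi_conv[of \<theta> 1 0] unfolding l by (metis (no_types, lifting) mult.right_neutral norm_cis norm_mult power_one_right)
    also have "\<dots> \<le> exp (ln 2) - 1 - c * \<theta>\<^sup>2"
      using norm_exp_minus_one_le[OF ln2 t] by (simp add: c_def)
    also have "\<dots> = 1 + (- c * \<theta>\<^sup>2)" by simp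
    also have "\<dots> \<le> exp (- c * \<theta>\<^sup>2)" by (rule exp_ge_add_one_self)
    finally show ?thesis .
  qed
  show ?thesis
  proof (rule exI[of _ c], rule conjI[OF c], rule allI, rule impI)
    fix \<theta> :: real assume "\<bar>\<theta>\<bar> \<le> pi"
    then show "norm (Psi (of_real \<theta>)) \<le> exp (- c * \<theta>\<^sup>2)" by (rule le)
  qed
qed

lemma surj_coeff_Psi:
  "surj_coeff k m = (LINT \<theta>:{-pi..pi}|lborel. Psi (of_real \<theta>) ^ k * cis (- ((real m - 2 * ln 2 * real k) * \<theta>))) / (2 * pi)"
  unfolding surj_coeff_def Psi_conv ..

lemma gaussian_integral:
  assumes "c > 0" shows "(LINT y|lborel. exp (- c * y\<^sup>2)) = sqrt (pi / c)"
proof -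
  have "complex_of_real (LINT y|lborel. exp (- c * y\<^sup>2)) = (LINT y|lborel. exp (- (2 * c * y\<^sup>2 / 2)) *\<^sub>R cis (- 0 * y))"
    unfolding integral_complex_of_real[symmetric] by (simp add: scaleR_conv_of_real)
  also have "\<dots> = complex_of_real (sqrt (2 * pi / (2 * c)) * exp (- 0\<^sup>2 / (2 * (2 * c))))"
    using assms by (intro integral_gaussian_cis) simp
  also have "\<dots> = complex_of_real (sqrt (pi / c))" by simp
  finally show ?thesis by (simp only: of_real_eq_iff)
qed

lemma norm_set_integral_gaussian_le:
  fixes f :: "real \<Rightarrow> complex"
  assumes "c > 0" "continuous_on {-pi..pi} f" "M \<ge> 0"
    and "\<And>\<theta>. \<bar>\<theta>\<bar> \<le> pi \<Longrightarrow> norm (f \<theta>) \<le> M * exp (- c * \<theta>\<^sup>2)"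
  shows "norm (LINT \<theta>:{-pi..pi}|lborel. f \<theta>) \<le> M * sqrt (pi / c)"
proof -
  have "norm (LINT \<theta>:{-pi..pi}|lborel. f \<theta>) \<le> (LINT \<theta>|lborel. M * exp (- c * \<theta>\<^sup>2))"
    unfolding set_lebesgue_integral_def
  proof (rule Bochner_Integration.integral_norm_bound_integral)
    show "integrable lborel (\<lambda>\<theta>. indicator {-pi..pi} \<theta> *\<^sub>R f \<theta>)"
      by (rule borel_integrable_compact) (use assms in auto)
    show "integrable lborel (\<lambda>\<theta>. M * exp (- c * \<theta>\<^sup>2))"
      using integrable_gaussian[OF assms(1)] by simp
    show "norm (indicator {-pi..pi} \<theta> *\<^sub>R f \<theta>) \<le> M * exp (- c * \<theta>\<^sup>2)" for \<theta>
      using assms(3) assms(4)[of \<theta>] by (auto simp: indicator_def)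
  qed
  also have "\<dots> = M * sqrt (pi / c)"
    using gaussian_integral[OF assms(1)] by simp
  finally show ?thesis .
qed

section \<open>Uniform bounds and the local limit for the surjection coefficients\<close>

text \<open>The k-th power is below exp (-c k \<theta>^2), whose integral is of order 1 / sqrt k.
  The bound is uniform in m and serves near the peak, where the decay estimate is void.\<close>

lemma surj_coeff_bound:
  "\<exists>C. \<forall>k m. sqrt (real k) * norm (surj_coeff k m) \<le> C"
proof -
  from Psi_norm_le obtain c where c: "c > 0"
    and norm_Psi: "\<forall>\<theta>. \<bar>\<theta>\<bar> \<le> pi \<longrightarrow> norm (Psi (of_real \<theta>)) \<le> exp (- c * \<theta>\<^sup>2)"
    by (elim exE conjE)
  have "sqrt (real k) * norm (surj_coeff k m) \<le> sqrt (pi / c)" for k m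
  proof (cases "k = 0")
    case False
    define x where "x = real m - 2 * ln 2 * real k"
    have "norm (LINT \<theta>:{-pi..pi}|lborel. Psi (of_real \<theta>) ^ k * cis (- (x * \<theta>))) \<le> 1 * sqrt (pi / (c * real k))"
    proof (rule norm_set_integral_gaussian_le)
      show "c * real k > 0" using c False by simp
      show "continuous_on {-pi..pi} (\<lambda>\<theta>. Psi (of_real \<theta>) ^ k * cis (- (x * \<theta>)))"
        by (intro continuous_intros)
      show "norm (Psi (of_real \<theta>) ^ k * cis (- (x * \<theta>))) \<le> 1 * exp (- (c * real k) * \<theta>\<^sup>2)" if "\<bar>\<theta>\<bar> \<le> pi" for \<theta>
      proof -
        have "norm (Psi (of_real \<theta>)) ^ k \<le> exp (- c * \<theta>\<^sup>2) ^ k" using norm_Psi[rule_format, OF that] by (intro power_mono) auto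
        also have "\<dots> = exp (- (c * real k) * \<theta>\<^sup>2)"
          by (subst exp_of_nat_mult[symmetric]) (simp add: mult_ac)
        finally show ?thesis by (simp only: norm_mult norm_power norm_cis mult_1_left mult_1_right)
      qed
    qed auto
    then have "norm (LINT \<theta>:{-pi..pi}|lborel. Psi (of_real \<theta>) ^ k * cis (- (x * \<theta>))) / (2 * pi) \<le> sqrt (pi / (c * real k)) / (2 * pi)"
      by (intro divide_right_mono) auto
    also have "\<dots> \<le> sqrt (pi / (c * real k)) / 1" using pi_gt3 c by (intro divide_left_mono) auto
    finally have "norm (surj_coeff k m) \<le> sqrt (pi / (c * real k))"
      by (simp only: surj_coeff_Psi x_def[symmetric] norm_divide) simp
    then have "sqrt (real k) * norm (surj_coeff k m) \<le> sqrt (real k) * sqrt (pi / (c * real k))"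
      by (intro mult_left_mono) auto
    also have "\<dots> = sqrt (pi / c)" using False by (simp add: real_sqrt_mult real_sqrt_divide)
    finally show ?thesis .
  qed (use c in auto)
  then show ?thesis by blast
qed

text \<open>\<open>Psi1\<close> vanishes at 0 and its derivative is bounded on a compact disc, so
  the mean value inequality applies.\<close>

lemma Psi1_norm_le:
  "\<exists>M\<ge>0. \<forall>\<theta>::real. \<bar>\<theta>\<bar> \<le> pi \<longrightarrow> norm (Psi1 (of_real \<theta>)) \<le> M * \<bar>\<theta>\<bar>"
proof -
  have "compact (Psi2 ` cball 0 pi)"
    by (intro compact_continuous_image continuous_at_imp_continuous_on ballI isCont_Psi2 compact_cball)
  then obtain M where M: "\<And>z. z \<in> cball 0 pi \<Longrightarrow> norm (Psi2 z) \<le> M"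
    using compact_imp_bounded bounded_iff by (metis image_eqI)
  show ?thesis
  proof (intro exI conjI allI impI)
    show "M \<ge> 0" using M[of 0] norm_ge_zero order_trans by (metis centre_in_cball pi_ge_zero)
    fix \<theta> :: real assume t: "\<bar>\<theta>\<bar> \<le> pi"
    have "norm (Psi1 (of_real \<theta>) - Psi1 0) \<le> M * norm (of_real \<theta> - 0 :: complex)"
    proof (rule field_differentiable_bound)
      show "convex (cball (0::complex) pi)" by simp
      show "(Psi1 has_field_derivative Psi2 z) (at z within cball 0 pi)" for z
        by (rule has_field_derivative_at_within[OF Psi_deriv(2)])
    qed (use M t in auto)
    then show "norm (Psi1 (of_real \<theta>)) \<le> M * \<bar>\<theta>\<bar>" by (simp add: Psi_0)
  qed
qed

text \<open>Lets part of a Gaussian absorb a linear factor.\<close>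

lemma le_exp_square: "y \<le> exp (y\<^sup>2)" for y :: real
proof -
  have "y \<le> 1 + y\<^sup>2" using self_le_power[of y 2] zero_le_power2[of y] by (cases "y \<le> 1") linarith+
  also have "\<dots> \<le> exp (y\<^sup>2)" by (rule exp_ge_add_one_self)
  finally show ?thesis .
qed

text \<open>One integration by parts; the recentring makes \<open>Psi1\<close> vanish at the origin, which pays for the factor \<open>k\<close> of the derivative.\<close>
lemma surj_coeff_decay:
  "\<exists>C. \<forall>k m. \<bar>real m - 2 * ln 2 * real k\<bar> * norm (surj_coeff k m) \<le> C"
proof -
  from Psi_norm_le obtain c where c: "c > 0"
    and norm_Psi: "\<forall>\<theta>. \<bar>\<theta>\<bar> \<le> pi \<longrightarrow> norm (Psi (of_real \<theta>)) \<le> exp (- c * \<theta>\<^sup>2)"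
    by (elim exE conjE)
  from Psi1_norm_le obtain M where M: "M \<ge> 0"
    and norm_Psi1: "\<forall>\<theta>::real. \<bar>\<theta>\<bar> \<le> pi \<longrightarrow> norm (Psi1 (of_real \<theta>)) \<le> M * \<bar>\<theta>\<bar>"
    by (elim exE conjE)
  \<comment> \<open>The factor exp (c pi^2) pays for the power k - 1 in place of k, sqrt (2 / c) for
    measuring \<theta> in units of y below, and the last root is the integral of the half of the
    Gaussian that is kept.\<close>
  define C where "C = M * exp (c * pi\<^sup>2) * sqrt (2 / c) * sqrt (pi / (c / 2))"
  have "\<bar>real m - 2 * ln 2 * real k\<bar> * norm (surj_coeff k m) \<le> C" for k m
  proof -
    define x where "x = real m - 2 * ln 2 * real k"
    define F where "F \<theta> = Psi (of_real \<theta>) ^ k * cis (- (x * \<theta>))" for \<theta>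
    define A where "A \<theta> = of_nat k * Psi (of_real \<theta>) ^ (k - 1) * Psi1 (of_real \<theta>) * cis (- (x * \<theta>))" for \<theta>
    have contF: "continuous_on S F" for S unfolding F_def by (intro continuous_intros)
    have contA: "continuous_on S A" for S unfolding A_def by (intro continuous_intros)
    have dP: "((\<lambda>\<theta>. Psi (of_real \<theta>)) has_vector_derivative Psi1 (of_real \<theta>)) (at \<theta> within S)" for \<theta> S
      by (rule has_vector_derivative_real_field[OF Psi_deriv(1)])
    have dF: "(F has_vector_derivative (A \<theta> - \<i> * x * F \<theta>)) (at \<theta> within S)" for \<theta> S
    proof -
      have "((\<lambda>z. Psi z ^ k * exp (- (\<i> * of_real x * z))) has_field_derivative
         (of_nat k * Psi z ^ (k - 1) * Psi1 z * exp (- (\<i> * of_real x * z)) - \<i> * of_real x * (Psi z ^ k * exp (- (\<i> * of_real x * z))))) (at z)" for z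
        by (auto intro!: derivative_eq_intros Psi_deriv(1))
      from has_vector_derivative_real_field[OF this]
      show ?thesis unfolding F_def A_def cis_conv_exp by (simp add: mult_ac)
    qed
    \<comment> \<open>The shift 2 k ln 2 inside x undoes the recentring of \<open>Psi\<close>; what
      remains depends on \<theta> only through cis \<theta> and cis (-m \<theta>) with m an integer.
      So the boundary terms cancel.\<close>
    have per: "F pi = F (- pi)"
    proof -
      have c: "cis (- pi) = - 1" "cis (- (real m * - pi)) = cis (- (real m * pi))"
        using Complex.DeMoivre[of pi m] Complex.DeMoivre[of "- pi" m] by (simp_all add: cis.code complex_eq_iff)
      show ?thesis unfolding F_def x_def Psi_conv[symmetric] c cis_pi ..
    qed
    have "(LINT \<theta>|lborel. indicator {-pi..pi} \<theta> *\<^sub>R (A \<theta> - \<i> * x * F \<theta>)) = F pi - F (- pi)"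
      by (rule integral_FTC_atLeastAtMost) (auto intro!: dF continuous_intros contA contF)
    then have "(LINT \<theta>:{-pi..pi}|lborel. A \<theta> - \<i> * x * F \<theta>) = 0"
      by (simp add: per set_lebesgue_integral_def)
    then have "(LINT \<theta>:{-pi..pi}|lborel. A \<theta>) = \<i> * x * (LINT \<theta>:{-pi..pi}|lborel. F \<theta>)"
      by (subst (asm) set_integral_diff) (auto intro!: borel_integrable_atLeastAtMost' continuous_intros contA contF)
    then have eq: "\<bar>x\<bar> * norm (LINT \<theta>:{-pi..pi}|lborel. F \<theta>) = norm (LINT \<theta>:{-pi..pi}|lborel. A \<theta>)"
      by (simp add: norm_mult)
    have "norm (LINT \<theta>:{-pi..pi}|lborel. A \<theta>) \<le> C"
    proof (cases "k = 0")
      case True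
      then show ?thesis using c M by (simp add: A_def C_def)
    next
      case False
      have "norm (LINT \<theta>:{-pi..pi}|lborel. A \<theta>) \<le> (M * exp (c * pi\<^sup>2) * sqrt (2 / c) * sqrt (real k)) * sqrt (pi / (c * real k / 2))"
      proof (rule norm_set_integral_gaussian_le)
        show "c * real k / 2 > 0" using c False by simp
        show "0 \<le> M * exp (c * pi\<^sup>2) * sqrt (2 / c) * sqrt (real k)" using c M by simp
        fix \<theta> :: real assume t: "\<bar>\<theta>\<bar> \<le> pi"
        have t2: "\<theta>\<^sup>2 \<le> pi\<^sup>2" using t by (simp add: abs_le_square_iff[symmetric])
        \<comment> \<open>Chosen so that exp (-2 y^2) = exp (-c k \<theta>^2). One half of the
          exponent is spent on the linear factor y, and k |\<theta>| becomes a multiple of sqrt k *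
          y; that sqrt k is cancelled by the remaining Gaussian integral.\<close>
        define y where "y = sqrt (c * real k / 2) * \<bar>\<theta>\<bar>"
        have y2: "y\<^sup>2 = c * real k / 2 * \<theta>\<^sup>2" using c by (simp add: y_def power_mult_distrib)
        have kt: "real k * \<bar>\<theta>\<bar> = sqrt (2 / c) * sqrt (real k) * y"
          using c by (simp add: y_def real_sqrt_mult real_sqrt_divide)
        have "norm (Psi (of_real \<theta>)) ^ (k - 1) \<le> exp (- c * \<theta>\<^sup>2) ^ (k - 1)"
          using norm_Psi[rule_format, OF t] by (intro power_mono) auto
        also have "\<dots> = exp (c * \<theta>\<^sup>2) * exp (- 2 * y\<^sup>2)"
          using False by (simp add: y2 exp_of_nat_mult[symmetric] exp_add[symmetric] of_nat_diff algebra_simps)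
        also have "\<dots> \<le> exp (c * pi\<^sup>2) * exp (- 2 * y\<^sup>2)" using c t2 by simp
        finally have 1: "norm (Psi (of_real \<theta>)) ^ (k - 1) \<le> exp (c * pi\<^sup>2) * exp (- 2 * y\<^sup>2)" .
        have "norm (A \<theta>) = real k * norm (Psi (of_real \<theta>)) ^ (k - 1) * norm (Psi1 (of_real \<theta>))"
          by (simp add: A_def norm_mult norm_power)
        also have "\<dots> \<le> real k * (exp (c * pi\<^sup>2) * exp (- 2 * y\<^sup>2)) * (M * \<bar>\<theta>\<bar>)"
          using 1 norm_Psi1[rule_format, OF t] by (intro mult_mono mult_left_mono) auto
        also have "\<dots> = (real k * \<bar>\<theta>\<bar>) * (M * exp (c * pi\<^sup>2) * exp (- 2 * y\<^sup>2))" by (simp add: mult_ac)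
        also have "\<dots> = (M * exp (c * pi\<^sup>2) * sqrt (2 / c) * sqrt (real k)) * exp (- 2 * y\<^sup>2) * y"
          unfolding kt by (simp add: mult_ac)
        also have "\<dots> \<le> (M * exp (c * pi\<^sup>2) * sqrt (2 / c) * sqrt (real k)) * exp (- 2 * y\<^sup>2) * exp (y\<^sup>2)"
          using c M by (intro mult_left_mono le_exp_square) auto
        also have "\<dots> = (M * exp (c * pi\<^sup>2) * sqrt (2 / c) * sqrt (real k)) * exp (- (c * real k / 2) * \<theta>\<^sup>2)"
          by (simp add: mult.assoc exp_add[symmetric] y2)
        finally show "norm (A \<theta>) \<le> M * exp (c * pi\<^sup>2) * sqrt (2 / c) * sqrt (real k) * exp (- (c * real k / 2) * \<theta>\<^sup>2)" .
      qed (rule contA)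
      also have "\<dots> = C" using False c by (simp add: C_def real_sqrt_mult real_sqrt_divide)
      finally show ?thesis .
    qed
    moreover have "norm (LINT \<theta>:{-pi..pi}|lborel. A \<theta>) / (2 * pi) \<le> norm (LINT \<theta>:{-pi..pi}|lborel. A \<theta>) / 1"
      using pi_gt3 by (intro divide_left_mono) auto
    moreover have "\<bar>x\<bar> * norm (surj_coeff k m) = norm (LINT \<theta>:{-pi..pi}|lborel. A \<theta>) / (2 * pi)"
      by (simp add: surj_coeff_Psi F_def[symmetric] x_def[symmetric] norm_divide eq[symmetric])
    ultimately show ?thesis by (simp add: x_def)
  qed
  then show ?thesis by blast
qed

text \<open>A sum of k variables of variance v fluctuates on the scale sqrt k, hence the normalised
  deviation \<xi>; the limit is the normal density of variance v at \<xi>.\<close>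

lemma surj_coeff_limit:
  fixes k m :: "nat \<Rightarrow> nat"
  assumes "filterlim k at_top sequentially"
    and "(\<lambda>n. (real (m n) - 2 * ln 2 * real (k n)) / sqrt (real (k n))) \<longlonglongrightarrow> \<xi>"
  defines "v \<equiv> 2 * ln 2 * (1 - ln 2 :: real)"
  shows "(\<lambda>n. sqrt (real (k n)) * norm (surj_coeff (k n) (m n))) \<longlonglongrightarrow> exp (- \<xi>\<^sup>2 / (2 * v)) / sqrt (2 * pi * v)"
proof -
  from Psi_norm_le obtain c where c: "c > 0"
    and norm_Psi: "\<forall>\<theta>. \<bar>\<theta>\<bar> \<le> pi \<longrightarrow> norm (Psi (of_real \<theta>)) \<le> exp (- c * \<theta>\<^sup>2)"
    by (elim exE conjE)
  have v: "v > 0" unfolding v_def using ln_2_less_1 by simp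
  define x where "x n = (real (m n) - 2 * ln 2 * real (k n)) / sqrt (real (k n))" for n
  define I where "I n = (LINT \<theta>:{-pi..pi}|lborel. Psi (of_real \<theta>) ^ k n * cis (- (x n * sqrt (real (k n)) * \<theta>)))" for n
  have "(\<lambda>n. sqrt (real (k n)) *\<^sub>R I n) \<longlonglongrightarrow> complex_of_real (sqrt (2 * pi / v) * exp (- \<xi>\<^sup>2 / (2 * v)))"
    unfolding I_def
  proof (rule fourier_local_limit[OF _ c v])
    show "((\<lambda>\<theta>. (Psi (of_real \<theta>) - exp (- (v * \<theta>\<^sup>2 / 2))) / of_real (\<theta>\<^sup>2)) \<longlongrightarrow> 0) (at 0)"
      unfolding v_def by (rule Psi_gaussian)
    show "continuous_on UNIV (\<lambda>\<theta>. Psi (complex_of_real \<theta>))" by (intro continuous_intros)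
    show "x \<longlonglongrightarrow> \<xi>" unfolding x_def[abs_def] by (rule assms(2))
    show "norm (Psi (complex_of_real \<theta>)) \<le> exp (- c * \<theta>\<^sup>2)" if "\<bar>\<theta>\<bar> \<le> pi" for \<theta>
      by (rule norm_Psi[rule_format, OF that])
    show "filterlim k at_top sequentially" by (rule assms(1))
  qed
  from tendsto_divide[OF tendsto_norm[OF this] tendsto_const[of "2 * pi"]]
  have "(\<lambda>n. norm (sqrt (real (k n)) *\<^sub>R I n) / (2 * pi)) \<longlonglongrightarrow> norm (complex_of_real (sqrt (2 * pi / v) * exp (- \<xi>\<^sup>2 / (2 * v)))) / (2 * pi)"
    by (simp only: pi_neq_zero mult_eq_0_iff zero_neq_numeral[symmetric] simp_thms not_False_eq_True)
  also have "norm (complex_of_real (sqrt (2 * pi / v) * exp (- \<xi>\<^sup>2 / (2 * v)))) / (2 * pi) = exp (- \<xi>\<^sup>2 / (2 * v)) / sqrt (2 * pi * v)"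
  proof -
    have "2 * pi / v = (2 * pi)\<^sup>2 / (2 * pi * v)" by (simp add: power2_eq_square)
    then have "sqrt (2 * pi / v) = sqrt ((2 * pi)\<^sup>2) / sqrt (2 * pi * v)" by (simp only: real_sqrt_divide)
    also have "sqrt ((2 * pi)\<^sup>2) = 2 * pi" by (rule real_sqrt_unique) auto
    finally have *: "sqrt (2 * pi / v) = 2 * pi / sqrt (2 * pi * v)" .
    have "sqrt (2 * pi / v) * exp (- \<xi>\<^sup>2 / (2 * v)) / (2 * pi) = exp (- \<xi>\<^sup>2 / (2 * v)) / sqrt (2 * pi * v)"
      unfolding * by simp
    moreover have "0 \<le> sqrt (2 * pi / v) * exp (- \<xi>\<^sup>2 / (2 * v))" using v by (intro mult_nonneg_nonneg) auto
    ultimately show ?thesis by (simp only: norm_of_real abs_of_nonneg)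
  qed
  finally have lim: "(\<lambda>n. norm (sqrt (real (k n)) *\<^sub>R I n) / (2 * pi)) \<longlonglongrightarrow> exp (- \<xi>\<^sup>2 / (2 * v)) / sqrt (2 * pi * v)" .
  have "eventually (\<lambda>n. k n > 0) sequentially"
    using assms(1) eventually_gt_at_top[of "0::nat"] by (rule eventually_compose_filterlim[rotated])
  then have "eventually (\<lambda>n. norm (sqrt (real (k n)) *\<^sub>R I n) / (2 * pi) = sqrt (real (k n)) * norm (surj_coeff (k n) (m n))) sequentially"
  proof eventually_elim
    case (elim n)
    then have "x n * sqrt (real (k n)) = real (m n) - 2 * ln 2 * real (k n)" by (simp add: x_def)
    then have "surj_coeff (k n) (m n) = I n / (2 * pi)" by (simp only: surj_coeff_Psi I_def)
    then show ?case by (simp add: norm_divide)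
  qed
  then show ?thesis by (rule Lim_transform_eventually[OF lim])
qed

section \<open>The asymptotics of the sum\<close>

text \<open>Turns the sum into an integral so that it can be rescaled and dominated. The index 0 is
  excluded because \<open>nat\<close> sends every negative real to 0, so its fibre has infinite
  measure.\<close>

lemma sum_eq_integral_floor:
  fixes a :: "nat \<Rightarrow> real"
  assumes "finite K" "0 \<notin> K"
  shows "(LINT u|lborel. (if nat \<lfloor>u::real\<rfloor> \<in> K then a (nat \<lfloor>u\<rfloor>) else 0)) = (\<Sum>k\<in>K. a k)"
proof -
  have eq: "(if nat \<lfloor>u\<rfloor> \<in> K then a (nat \<lfloor>u\<rfloor>) else 0) = (\<Sum>k\<in>K. indicator {real k..<real k + 1} u *\<^sub>R a k)" for u
  proof -
    have "indicator {real k..<real k + 1} u *\<^sub>R a k = (if nat \<lfloor>u\<rfloor> = k then a k else 0)" if "k \<in> K" for k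
    proof -
      have "k > 0" using that assms(2) by (cases k) auto
      then have "u \<in> {real k..<real k + 1} \<longleftrightarrow> nat \<lfloor>u\<rfloor> = k" by (simp add: nat_eq_iff) linarith
      then show ?thesis by (auto simp: indicator_def)
    qed
    then have "(\<Sum>k\<in>K. indicator {real k..<real k + 1} u *\<^sub>R a k) = (\<Sum>k\<in>K. if nat \<lfloor>u\<rfloor> = k then a k else 0)"
      by (intro sum.cong) auto
    then show ?thesis using assms(1) by simp
  qed
  have int: "integrable lborel (\<lambda>u. indicator {real k..<real k + 1} u *\<^sub>R a k)" for k
    by (intro integrable_scaleR_left integrable_real_indicator) auto
  have "(LINT u|lborel. indicator {real k..<real k + 1} u *\<^sub>R a k) = a k" for k
    by (subst integral_scaleR_left) (auto intro: integrable_real_indicator)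
  then show ?thesis using int
    by (subst Bochner_Integration.integral_cong[OF refl eq], subst Bochner_Integration.integral_sum) auto
qed

text \<open>A crude substitute for the logarithmic bound; it only has to be o(m) in
  \<open>small_part_limit\<close>.\<close>

lemma sum_inverse_le_sqrt: "(\<Sum>k=1..m. 1 / real k) \<le> 2 * sqrt (real m)"
proof (induction m)
  case (Suc m)
  define s t where "s = sqrt (real m)" and "t = sqrt (real (Suc m))"
  have st: "0 \<le> s" "s \<le> t" "t \<ge> 1" by (auto simp: s_def t_def)
  have "t\<^sup>2 - s\<^sup>2 = 1" by (simp add: s_def t_def)
  then have "(t - s) * (t + s) = 1" by (simp add: power2_eq_square algebra_simps)
  moreover have "(t - s) * (t + s) \<le> (t - s) * (2 * t)" using st by (intro mult_left_mono) auto
  ultimately have "1 \<le> 2 * (t - s) * t" by (simp add: mult_ac)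
  moreover have "2 * (t - s) * t \<le> 2 * (t - s) * t\<^sup>2"
    using st by (intro mult_left_mono) (auto simp: power2_eq_square)
  ultimately have "1 / t\<^sup>2 \<le> 2 * (t - s)" using st by (subst pos_divide_le_eq) auto
  then have "1 / real (Suc m) \<le> 2 * t - 2 * s" by (simp add: t_def)
  then show ?case using Suc.IH by (simp add: s_def t_def)
qed simp

text \<open>For 2 \<mu> k \<le> m the deviation m - \<mu> k is at least m / 2, so q \<le> 2 D / m,
  and the cubes contribute m^2 * m^(-3) * sqrt m up to a constant. These k are split off because
  there the weight 1 / k is not comparable to 1 / m.\<close>

lemma small_part_limit:
  fixes q :: "nat \<Rightarrow> nat \<Rightarrow> real"
  assumes q: "\<And>k m. q k m \<ge> 0" and \<mu>: "\<mu> > 0" and D: "\<And>k m. \<bar>real m - \<mu> * real k\<bar> * q k m \<le> D"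
  shows "(\<lambda>m. (real m)\<^sup>2 * (\<Sum>k | 1 \<le> k \<and> k \<le> m \<and> 2 * \<mu> * real k \<le> real m. q k m ^ 3 / real k)) \<longlonglongrightarrow> 0"
proof (rule Lim_null_comparison)
  show "eventually (\<lambda>m. norm ((real m)\<^sup>2 * (\<Sum>k | 1 \<le> k \<and> k \<le> m \<and> 2 * \<mu> * real k \<le> real m. q k m ^ 3 / real k))
     \<le> 16 * D ^ 3 * (sqrt (real m) / real m)) sequentially"
    using eventually_gt_at_top[of 0]
  proof eventually_elim
    case (elim m)
    define K where "K = {k. 1 \<le> k \<and> k \<le> m \<and> 2 * \<mu> * real k \<le> real m}"
    have K: "K \<subseteq> {1..m}" by (auto simp: K_def)
    have D0: "D \<ge> 0" using D[of 0 0] by simp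
    have "(\<Sum>k\<in>K. q k m ^ 3 / real k) \<le> (\<Sum>k\<in>K. (2 * D / real m) ^ 3 * (1 / real k))"
    proof (rule sum_mono)
      fix k assume "k \<in> K"
      then have "real m / 2 \<le> \<bar>real m - \<mu> * real k\<bar>" by (simp add: K_def)
      then have "real m / 2 * q k m \<le> \<bar>real m - \<mu> * real k\<bar> * q k m" using q by (intro mult_right_mono)
      also have "\<dots> \<le> D" by (rule D)
      finally have "q k m \<le> 2 * D / real m" using elim by (simp add: field_simps)
      then have "q k m ^ 3 \<le> (2 * D / real m) ^ 3" using q by (intro power_mono)
      then have "q k m ^ 3 / real k \<le> (2 * D / real m) ^ 3 / real k" by (intro divide_right_mono) auto
      then show "q k m ^ 3 / real k \<le> (2 * D / real m) ^ 3 * (1 / real k)" by simp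
    qed
    also have "\<dots> = (2 * D / real m) ^ 3 * (\<Sum>k\<in>K. 1 / real k)" by (simp only: sum_distrib_left)
    also have "\<dots> \<le> (2 * D / real m) ^ 3 * (2 * sqrt (real m))"
    proof (rule mult_left_mono)
      have "(\<Sum>k\<in>K. 1 / real k) \<le> (\<Sum>k=1..m. 1 / real k)" using K by (intro sum_mono2) auto
      also have "\<dots> \<le> 2 * sqrt (real m)" by (rule sum_inverse_le_sqrt)
      finally show "(\<Sum>k\<in>K. 1 / real k) \<le> 2 * sqrt (real m)" .
    qed (use D0 in auto)
    finally have "(real m)\<^sup>2 * (\<Sum>k\<in>K. q k m ^ 3 / real k) \<le> (real m)\<^sup>2 * ((2 * D / real m) ^ 3 * (2 * sqrt (real m)))"
      by (intro mult_left_mono) auto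
    also have "\<dots> = 16 * D ^ 3 * (sqrt (real m) / real m)"
      using elim by (simp add: field_simps power2_eq_square power3_eq_cube)
    finally show ?case unfolding K_def[symmetric] using q by (simp add: sum_nonneg)
  qed
  have "(\<lambda>m. sqrt (real m) / real m) \<longlonglongrightarrow> 0" by real_asymp
  then show "(\<lambda>m. 16 * D ^ 3 * (sqrt (real m) / real m)) \<longlonglongrightarrow> 0" by (rule tendsto_mult_right_zero)
qed

lemma integrable_inverse_quadratic: "integrable lborel (\<lambda>y::real. 1 / (1 + y\<^sup>2))"
  using integrable_inverse_1_plus_square by (simp add: set_integrable_def einterval_def inverse_eq_divide)

text \<open>For 2 \<mu> k > m the weight 1 / k is below 2 \<mu> / m, and Q = sqrt m * q is bounded
  both by a constant and, for large |y|, by a multiple of 1 / |y|. Taking the constant for one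
  factor and both bounds for the other two gives the majorant 1 / (1 + y^2). The condition \<mu> > 1
  puts the peak k = m / \<mu> inside the range k \<le> m.\<close>

lemma large_part_limit:
  fixes q :: "nat \<Rightarrow> nat \<Rightarrow> real"
  assumes q: "\<And>k m. q k m \<ge> 0" and \<mu>: "\<mu> > 1" "\<mu> < 2" and v: "v > 0"
    and C: "\<And>k m. sqrt (real k) * q k m \<le> C"
    and D: "\<And>k m. \<bar>real m - \<mu> * real k\<bar> * q k m \<le> D"
    and lim: "\<And>k m \<xi>. filterlim k at_top sequentially \<Longrightarrow>
       (\<lambda>n. (real (m n) - \<mu> * real (k n)) / sqrt (real (k n))) \<longlonglongrightarrow> \<xi> \<Longrightarrow>
       (\<lambda>n. sqrt (real (k n)) * q (k n) (m n)) \<longlonglongrightarrow> exp (- \<xi>\<^sup>2 / (2 * v)) / sqrt (2 * pi * v)"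
  shows "(\<lambda>m. (real m)\<^sup>2 * (\<Sum>k | 1 \<le> k \<and> k \<le> m \<and> \<not> 2 * \<mu> * real k \<le> real m. q k m ^ 3 / real k))
    \<longlonglongrightarrow> \<mu> / (2 * pi * v * sqrt 3)"
proof -
  define K where "K m = {k. 1 \<le> k \<and> k \<le> m \<and> \<not> 2 * \<mu> * real k \<le> real m}" for m
  have finK: "finite (K m)" "0 \<notin> K m" for m by (auto simp: K_def)
  \<comment> \<open>The sum is an integral over \<open>u\<close> with \<open>k = \<lfloor>u\<rfloor>\<close>, and \<open>u\<close> is rescaled around the peak \<open>m / \<mu>\<close> on the scale \<open>sqrt m\<close>.\<close>
  define \<kappa> where "\<kappa> m y = nat \<lfloor>real m / \<mu> + sqrt (real m) * y\<rfloor>" for m y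
  define G where "G m y = (if \<kappa> m y \<in> K m then (real m)\<^sup>2 * sqrt (real m) * (q (\<kappa> m y) m ^ 3 / real (\<kappa> m y)) else 0)" for m y
  \<comment> \<open>Up to the cutoff to \<open>K m\<close>, \<open>G m y\<close> is (sqrt k * q)^3 *
    (m / k)^(5/2). The ratio m / k tends to \<mu>, and (m - \<mu> k) / sqrt k tends to -\<mu> sqrt
    \<mu> y, the point at which the local limit is evaluated.\<close>
  define L where "L y = (exp (- (- (\<mu> * sqrt \<mu> * y))\<^sup>2 / (2 * v)) / sqrt (2 * pi * v)) ^ 3 * (\<mu>\<^sup>2 * sqrt \<mu>)" for y
  \<comment> \<open>The two entries treat |y| < 2, where 1 + y^2 \<le> 5, and |y| \<ge> 2, where 1 +
    y^2 \<le> 2 y^2.\<close>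
  define E where "E = max (5 * (C * sqrt (2 * \<mu>))\<^sup>2) (2 * (2 * D / \<mu>)\<^sup>2)"
  define W where "W = 2 * \<mu> * (C * sqrt (2 * \<mu>)) * E"
  have E0: "E \<ge> 0" unfolding E_def by (rule max.coboundedI1) simp
  have C0: "C \<ge> 0" using C[of 0 0] by simp
  have D0: "D \<ge> 0" using D[of 0 0] by simp
  have sum_eq: "(real m)\<^sup>2 * (\<Sum>k\<in>K m. q k m ^ 3 / real k) = (LINT y|lborel. G m y)" if "m > 0" for m
  proof -
    have "(\<Sum>k\<in>K m. q k m ^ 3 / real k) = (LINT u|lborel. (if nat \<lfloor>u::real\<rfloor> \<in> K m then q (nat \<lfloor>u\<rfloor>) m ^ 3 / real (nat \<lfloor>u\<rfloor>) else 0))"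
      by (rule sum_eq_integral_floor[symmetric, OF finK])
    also have "\<dots> = \<bar>sqrt (real m)\<bar> *\<^sub>R (LINT y|lborel. (if \<kappa> m y \<in> K m then q (\<kappa> m y) m ^ 3 / real (\<kappa> m y) else 0))"
      unfolding \<kappa>_def using that by (intro lborel_integral_real_affine) auto
    finally have "(real m)\<^sup>2 * (\<Sum>k\<in>K m. q k m ^ 3 / real k) = (real m)\<^sup>2 * sqrt (real m) * (LINT y|lborel. (if \<kappa> m y \<in> K m then q (\<kappa> m y) m ^ 3 / real (\<kappa> m y) else 0))"
      by simp
    also have "\<dots> = (LINT y|lborel. (real m)\<^sup>2 * sqrt (real m) * (if \<kappa> m y \<in> K m then q (\<kappa> m y) m ^ 3 / real (\<kappa> m y) else 0))"
      by (rule integral_mult_right_zero[symmetric])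
    also have "\<dots> = (LINT y|lborel. G m y)" unfolding G_def by (intro Bochner_Integration.integral_cong) auto
    finally show ?thesis .
  qed
  have "(\<lambda>m. LINT y|lborel. G m y) \<longlonglongrightarrow> (LINT y|lborel. L y)"
  proof (rule integral_dominated_convergence[where w = "\<lambda>y. W * (1 / (1 + y\<^sup>2))"])
    show "integrable lborel (\<lambda>y. W * (1 / (1 + y\<^sup>2)))"
      using integrable_inverse_quadratic by (rule integrable_mult_right)
    have [measurable]: "(\<lambda>y. \<kappa> m y) \<in> measurable borel (count_space UNIV)" for m
      unfolding \<kappa>_def by measurable
    show "G m \<in> borel_measurable lborel" for m
      unfolding G_def by measurable
    show "L \<in> borel_measurable lborel" unfolding L_def by measurable
    show "AE y in lborel. norm (G m y) \<le> W * (1 / (1 + y\<^sup>2))" for m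
    proof (rule AE_I2)
      fix y
      have W0: "W \<ge> 0" unfolding W_def using C0 E0 \<mu> by (intro mult_nonneg_nonneg) auto
      show "norm (G m y) \<le> W * (1 / (1 + y\<^sup>2))"
      proof (cases "\<kappa> m y \<in> K m")
        case True
        define k where "k = \<kappa> m y"
        have k: "k \<ge> 1" "k \<le> m" "2 * \<mu> * real k > real m" using True by (auto simp: K_def k_def)
        have m: "real m \<ge> 1" using k by simp
        have sm: "sqrt (real m) > 0" "sqrt (real m) \<ge> 1" using m by auto
        define Q where "Q = sqrt (real m) * q k m"
        have Q0: "Q \<ge> 0" using q by (simp add: Q_def)
        have "sqrt (real m) \<le> sqrt (2 * \<mu> * real k)" using k by simp
        also have "\<dots> = sqrt (2 * \<mu>) * sqrt (real k)" by (simp add: real_sqrt_mult)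
        finally have "Q \<le> sqrt (2 * \<mu>) * sqrt (real k) * q k m" unfolding Q_def using q by (intro mult_right_mono)
        also have "\<dots> \<le> sqrt (2 * \<mu>) * C" unfolding mult.assoc using \<mu> C by (intro mult_left_mono) auto
        finally have Q1: "Q \<le> C * sqrt (2 * \<mu>)" by (simp add: mult.commute)
        have Q2: "Q\<^sup>2 * (1 + y\<^sup>2) \<le> E"
        proof (cases "\<bar>y\<bar> < 2")
          case True
          then have "y\<^sup>2 \<le> 2\<^sup>2" using power_mono[of "\<bar>y\<bar>" 2 2] by simp
          then have "1 + y\<^sup>2 \<le> 5" by simp
          moreover have "Q\<^sup>2 \<le> (C * sqrt (2 * \<mu>))\<^sup>2" using Q0 Q1 by (intro power_mono)
          ultimately have "Q\<^sup>2 * (1 + y\<^sup>2) \<le> (C * sqrt (2 * \<mu>))\<^sup>2 * 5" by (intro mult_mono) auto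
          then show ?thesis by (simp add: E_def)
        next
          case False
          \<comment> \<open>Rounding u to the integer k shifts \<mu> k by at most \<mu>. As sqrt m *
            |y| \<ge> 2, this is at most half of \<mu> sqrt m |y|, so half of the deviation
            survives.\<close>
          define u where "u = real m / \<mu> + sqrt (real m) * y"
          have "nat \<lfloor>u\<rfloor> = k" by (simp add: k_def \<kappa>_def u_def)
          then have u: "\<bar>real k - u\<bar> \<le> 1" using k by linarith
          have "\<mu> * (u - real k) = (real m - \<mu> * real k) + \<mu> * sqrt (real m) * y"
            using \<mu> by (simp add: u_def algebra_simps)
          then have "\<bar>\<mu> * sqrt (real m) * y\<bar> \<le> \<bar>real m - \<mu> * real k\<bar> + \<bar>\<mu> * (real k - u)\<bar>"
            by (simp add: algebra_simps)
          then have "\<mu> * sqrt (real m) * \<bar>y\<bar> \<le> \<bar>real m - \<mu> * real k\<bar> + \<mu> * \<bar>real k - u\<bar>"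
            using \<mu> by (simp add: abs_mult)
          also have "\<dots> \<le> \<bar>real m - \<mu> * real k\<bar> + \<mu> * 1" using u \<mu> by (intro add_left_mono mult_left_mono) auto
          finally have 1: "\<mu> * sqrt (real m) * \<bar>y\<bar> - \<mu> \<le> \<bar>real m - \<mu> * real k\<bar>" by simp
          have "2 \<le> sqrt (real m) * \<bar>y\<bar>" using mult_mono[of 1 "sqrt (real m)" 2 "\<bar>y\<bar>"] False sm by simp
          then have "\<mu> * 2 \<le> \<mu> * (sqrt (real m) * \<bar>y\<bar>)" using \<mu> by (intro mult_left_mono) auto
          with 1 have "\<mu> / 2 * sqrt (real m) * \<bar>y\<bar> \<le> \<bar>real m - \<mu> * real k\<bar>" by (simp add: mult.assoc)
          then have "\<mu> / 2 * sqrt (real m) * \<bar>y\<bar> * q k m \<le> \<bar>real m - \<mu> * real k\<bar> * q k m"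
            using q by (intro mult_right_mono)
          also have "\<dots> \<le> D" by (rule D)
          finally have "Q * \<bar>y\<bar> \<le> 2 * D / \<mu>" using \<mu> by (simp add: Q_def field_simps)
          then have "(Q * \<bar>y\<bar>)\<^sup>2 \<le> (2 * D / \<mu>)\<^sup>2" using Q0 by (intro power_mono) auto
          then have "Q\<^sup>2 * y\<^sup>2 \<le> (2 * D / \<mu>)\<^sup>2" by (simp add: power_mult_distrib)
          moreover have "1 \<le> y\<^sup>2" using False abs_le_square_iff[of 1 y] by simp
          then have "Q\<^sup>2 * 1 \<le> Q\<^sup>2 * y\<^sup>2" by (intro mult_left_mono) auto
          ultimately have "Q\<^sup>2 * (1 + y\<^sup>2) \<le> 2 * (2 * D / \<mu>)\<^sup>2" by (simp add: algebra_simps)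
          then show ?thesis by (simp add: E_def)
        qed
        have "sqrt (real m) * sqrt (real m) = real m" by simp
        then have "(real m)\<^sup>2 * sqrt (real m) * (q k m ^ 3 / real k) = Q * Q\<^sup>2 * (real m / real k)"
          unfolding Q_def by (simp add: power2_eq_square power3_eq_cube)
        also have "\<dots> \<le> (C * sqrt (2 * \<mu>)) * (E / (1 + y\<^sup>2)) * (2 * \<mu>)"
        proof (intro mult_mono)
          have "1 + y\<^sup>2 > 0" by (rule add_pos_nonneg) auto
          then show "Q\<^sup>2 \<le> E / (1 + y\<^sup>2)" using Q2 by (simp add: pos_le_divide_eq)
          show "real m / real k \<le> 2 * \<mu>" using k by (simp add: field_simps)
          show "0 \<le> C * sqrt (2 * \<mu>) * (E / (1 + y\<^sup>2))" using C0 \<mu> by (intro mult_nonneg_nonneg divide_nonneg_nonneg) (use E0 in auto)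
        qed (use Q0 Q1 C0 \<mu> in auto)
        also have "\<dots> = W * (1 / (1 + y\<^sup>2))" by (simp add: W_def)
        finally have "(real m)\<^sup>2 * sqrt (real m) * (q k m ^ 3 / real k) \<le> W * (1 / (1 + y\<^sup>2))" .
        moreover have "0 \<le> (real m)\<^sup>2 * sqrt (real m) * (q k m ^ 3 / real k)" using q by simp
        ultimately show ?thesis using True by (simp add: G_def k_def)
      qed (use W0 in \<open>simp add: G_def\<close>)
    qed
    show "AE y in lborel. (\<lambda>m. G m y) \<longlonglongrightarrow> L y"
    proof (rule AE_I2)
      fix y
      have \<mu>0: "\<mu> > 0" using \<mu> by simp
      have u: "filterlim (\<lambda>m. real m / \<mu> + sqrt (real m) * y) at_top sequentially"
        using \<mu>0 by real_asymp
      define r where "r m = real (\<kappa> m y) / real m" for m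
      have bnd: "eventually (\<lambda>m. real (\<kappa> m y) \<le> real m / \<mu> + sqrt (real m) * y \<and> real m / \<mu> + sqrt (real m) * y - 1 \<le> real (\<kappa> m y)) sequentially"
        using filterlim_at_top_dense[THEN iffD1, OF u, rule_format, of 0]
        by eventually_elim (unfold \<kappa>_def, linarith)
      have kt: "filterlim (\<lambda>m. real (\<kappa> m y)) at_top sequentially"
      proof (rule filterlim_at_top_mono)
        show "filterlim (\<lambda>m. real m / \<mu> + sqrt (real m) * y - 1) at_top sequentially" using \<mu>0 by real_asymp
        show "eventually (\<lambda>m. real m / \<mu> + sqrt (real m) * y - 1 \<le> real (\<kappa> m y)) sequentially"
          using bnd by eventually_elim simp
      qed
      then have kt': "filterlim (\<lambda>m. \<kappa> m y) at_top sequentially"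
        unfolding filterlim_sequentially_iff_filterlim_real .
      have r: "r \<longlonglongrightarrow> 1 / \<mu>"
      proof (rule tendsto_sandwich)
        show "(\<lambda>m. (real m / \<mu> + sqrt (real m) * y - 1) / real m) \<longlonglongrightarrow> 1 / \<mu>" using \<mu>0 by real_asymp (simp add: inverse_eq_divide)
        show "(\<lambda>m. (real m / \<mu> + sqrt (real m) * y) / real m) \<longlonglongrightarrow> 1 / \<mu>" using \<mu>0 by real_asymp (simp add: inverse_eq_divide)
        show "eventually (\<lambda>m. (real m / \<mu> + sqrt (real m) * y - 1) / real m \<le> r m) sequentially"
          using bnd by eventually_elim (auto simp: r_def intro!: divide_right_mono)
        show "eventually (\<lambda>m. r m \<le> (real m / \<mu> + sqrt (real m) * y) / real m) sequentially"
          using bnd by eventually_elim (auto simp: r_def intro!: divide_right_mono)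
      qed
      have kpos: "eventually (\<lambda>m. \<kappa> m y \<ge> 1) sequentially"
        using kt' unfolding filterlim_at_top by blast
      have mpos: "eventually (\<lambda>m::nat. m > 0) sequentially" by (rule eventually_gt_at_top)
      have d: "(\<lambda>m. (real m - \<mu> * real (\<kappa> m y)) / sqrt (real m)) \<longlonglongrightarrow> - (\<mu> * y)"
      proof (rule tendsto_sandwich)
        show "(\<lambda>m. (real m - \<mu> * (real m / \<mu> + sqrt (real m) * y)) / sqrt (real m)) \<longlonglongrightarrow> - (\<mu> * y)"
          using \<mu>0 by real_asymp
        show "(\<lambda>m. (real m - \<mu> * (real m / \<mu> + sqrt (real m) * y - 1)) / sqrt (real m)) \<longlonglongrightarrow> - (\<mu> * y)"
          using \<mu>0 by real_asymp
        show "eventually (\<lambda>m. (real m - \<mu> * (real m / \<mu> + sqrt (real m) * y)) / sqrt (real m) \<le> (real m - \<mu> * real (\<kappa> m y)) / sqrt (real m)) sequentially"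
          using bnd by eventually_elim (use \<mu>0 in \<open>auto intro!: divide_right_mono mult_left_mono\<close>)
        show "eventually (\<lambda>m. (real m - \<mu> * real (\<kappa> m y)) / sqrt (real m) \<le> (real m - \<mu> * (real m / \<mu> + sqrt (real m) * y - 1)) / sqrt (real m)) sequentially"
          using bnd by eventually_elim (use \<mu>0 in \<open>auto intro!: divide_right_mono mult_left_mono\<close>)
      qed
      \<comment> \<open>Dividing by sqrt (k / m) changes the unit from sqrt m to sqrt k.\<close>
      have "(\<lambda>m. (real m - \<mu> * real (\<kappa> m y)) / sqrt (real m) / sqrt (r m)) \<longlonglongrightarrow> - (\<mu> * y) / sqrt (1 / \<mu>)"
        using \<mu>0 by (intro tendsto_divide[OF d] tendsto_real_sqrt[OF r]) auto
      also have "- (\<mu> * y) / sqrt (1 / \<mu>) = - (\<mu> * sqrt \<mu> * y)" using \<mu>0 by (simp add: real_sqrt_divide)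
      finally have "(\<lambda>m. (real m - \<mu> * real (\<kappa> m y)) / sqrt (real (\<kappa> m y))) \<longlonglongrightarrow> - (\<mu> * sqrt \<mu> * y)"
        by (rule Lim_transform_eventually) (use mpos in \<open>eventually_elim, simp add: r_def real_sqrt_divide\<close>)
      from lim[OF kt' this]
      have "(\<lambda>m. (sqrt (real (\<kappa> m y)) * q (\<kappa> m y) m) ^ 3 * ((1 / r m)\<^sup>2 * sqrt (1 / r m))) \<longlonglongrightarrow>
         (exp (- (- (\<mu> * sqrt \<mu> * y))\<^sup>2 / (2 * v)) / sqrt (2 * pi * v)) ^ 3 * ((1 / (1 / \<mu>))\<^sup>2 * sqrt (1 / (1 / \<mu>)))"
        using \<mu>0 by (intro tendsto_mult tendsto_power tendsto_real_sqrt tendsto_divide[OF tendsto_const r]) auto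
      moreover have "eventually (\<lambda>m. (sqrt (real (\<kappa> m y)) * q (\<kappa> m y) m) ^ 3 * ((1 / r m)\<^sup>2 * sqrt (1 / r m)) = G m y) sequentially"
      proof -
        have "1 / (2 * \<mu>) < 1 / \<mu>" "1 / \<mu> < 1" using \<mu> by (auto simp: field_simps)
        then have "eventually (\<lambda>m. 1 / (2 * \<mu>) < r m) sequentially" "eventually (\<lambda>m. r m < 1) sequentially"
          using r order_tendsto_iff by blast+
        then show ?thesis using kpos mpos
        proof eventually_elim
          case (elim m)
          define k where "k = \<kappa> m y"
          have k: "k \<ge> 1" using elim by (simp add: k_def)
          have "k \<in> K m" using elim \<mu>0 by (auto simp: K_def r_def k_def field_simps)
          moreover have "(sqrt (real k) * q k m) ^ 3 * ((1 / (real k / real m))\<^sup>2 * sqrt (1 / (real k / real m)))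
             = (real m)\<^sup>2 * sqrt (real m) * (q k m ^ 3 / real k)"
          proof -
            have s: "sqrt (real k) ^ 3 = real k * sqrt (real k)" by (simp add: power3_eq_cube)
            show ?thesis using k
              by (simp add: power_mult_distrib s real_sqrt_divide power_divide) (simp add: field_simps power2_eq_square)
          qed
          ultimately show ?case by (simp add: G_def k_def r_def)
        qed
      qed
      ultimately show "(\<lambda>m. G m y) \<longlonglongrightarrow> L y" by (auto simp: L_def intro: Lim_transform_eventually)
    qed
  qed
  also have "(LINT y|lborel. L y) = \<mu> / (2 * pi * v * sqrt 3)"
  proof -
    \<comment> \<open>Cubing the density triples the exponent; this 3 is the source of sqrt 3 in the
      result.\<close>
    define c where "c = 3 * \<mu> ^ 3 / (2 * v)"
    define A where "A = \<mu>\<^sup>2 * sqrt \<mu> / sqrt (2 * pi * v) ^ 3"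
    have c: "c > 0" using \<mu> v by (simp add: c_def)
    have "L y = A * exp (- c * y\<^sup>2)" for y
    proof -
      have "exp (- (- (\<mu> * sqrt \<mu> * y))\<^sup>2 / (2 * v)) ^ 3 = exp (- c * y\<^sup>2)"
      proof -
        have "real 3 * (- (- (\<mu> * sqrt \<mu> * y))\<^sup>2 / (2 * v)) = - c * y\<^sup>2"
          using \<mu> by (simp add: c_def power_mult_distrib power2_eq_square power3_eq_cube)
        then show ?thesis by (simp only: exp_of_nat_mult[symmetric])
      qed
      then show ?thesis by (simp add: L_def A_def power_divide)
    qed
    then have "(LINT y|lborel. L y) = A * sqrt (pi / c)" using gaussian_integral[OF c] by simp
    also have "\<dots> = \<mu> / (2 * pi * v * sqrt 3)"
    proof -
      define s where "s = sqrt (2 * pi * v)"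
      have s: "s > 0" "s * s = 2 * pi * v" using v by (auto simp: s_def)
      have "pi / c = (2 * pi * v) / (3 * \<mu> ^ 3)" by (simp add: c_def)
      then have "sqrt (pi / c) = s / (sqrt 3 * (\<mu> * sqrt \<mu>))"
        using \<mu> by (simp add: s_def real_sqrt_divide real_sqrt_mult power3_eq_cube)
      then have "A * sqrt (pi / c) = \<mu> / ((s * s) * sqrt 3)"
        using \<mu> s by (simp add: A_def s_def[symmetric] power3_eq_cube power2_eq_square)
      then show ?thesis unfolding s .
    qed
    finally show ?thesis .
  qed
  finally show ?thesis
    by (rule Lim_transform_eventually)
       (use eventually_gt_at_top[of "0::nat"] in \<open>eventually_elim, simp only: sum_eq[symmetric] K_def\<close>)
qed

section \<open>Counting surjections and identifying them with the coefficients\<close>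

definition surjections :: "'a set \<Rightarrow> 'b set \<Rightarrow> ('a \<Rightarrow> 'b) set" where
  "surjections A B = {f \<in> A \<rightarrow>\<^sub>E B. f ` A = B}"

lemma finite_surjections: "finite A \<Longrightarrow> finite B \<Longrightarrow> finite (surjections A B)"
  unfolding surjections_def by (rule finite_subset[OF _ finite_PiE[of A "\<lambda>_. B"]]) auto

text \<open>Every map from A to B is a surjection onto its own image.\<close>

lemma sum_card_surjections:
  assumes "finite A" "finite B"
  shows "(\<Sum>C\<in>Pow B. card (surjections A C)) = card B ^ card A"
proof -
  have "A \<rightarrow>\<^sub>E B = (\<Union>C\<in>Pow B. surjections A C)"
  proof (intro equalityI subsetI)
    fix f assume "f \<in> A \<rightarrow>\<^sub>E B"
    then have "f ` A \<in> Pow B" "f \<in> surjections A (f ` A)" by (auto simp: surjections_def PiE_iff)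
    then show "f \<in> (\<Union>C\<in>Pow B. surjections A C)" by blast
  next
    fix f assume "f \<in> (\<Union>C\<in>Pow B. surjections A C)"
    then obtain C where "C \<subseteq> B" "f \<in> surjections A C" by blast
    then show "f \<in> A \<rightarrow>\<^sub>E B" by (auto simp: surjections_def PiE_iff)
  qed
  also have "card \<dots> = (\<Sum>C\<in>Pow B. card (surjections A C))"
  proof (rule card_UN_disjoint)
    show "finite (Pow B)" using assms by simp
    show "\<forall>C\<in>Pow B. finite (surjections A C)"
      using assms by (meson finite_surjections finite_subset PowD)
    show "\<forall>C\<in>Pow B. \<forall>D\<in>Pow B. C \<noteq> D \<longrightarrow> surjections A C \<inter> surjections A D = {}"
      by (auto simp: surjections_def)
  qed
  finally show ?thesis using assms by (simp add: card_PiE)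
qed

lemma sum_Pow_card:
  fixes g :: "nat \<Rightarrow> 'b :: comm_semiring_1"
  assumes "finite B"
  shows "(\<Sum>C\<in>Pow B. g (card C)) = (\<Sum>j\<le>card B. of_nat (card B choose j) * g j)"
proof -
  have "(\<Sum>C\<in>Pow B. g (card C)) = (\<Sum>j\<le>card B. \<Sum>C | C \<in> Pow B \<and> card C = j. g (card C))"
    using assms by (subst sum.group) (auto simp: card_mono)
  also have "\<dots> = (\<Sum>j\<le>card B. of_nat (card B choose j) * g j)"
    using n_subsets[OF assms] by (intro sum.cong) auto
  finally show ?thesis .
qed

text \<open>Summed over all subsets of B, both sides give (|B| ln 2)^m / m! with m = |A|. By
  induction they agree on proper subsets, hence on B itself: binomial inversion without alternating
  signs.\<close>

lemma card_surjections_fourier: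
  assumes "finite A" "finite B"
  shows "of_nat (card (surjections A B)) * ln 2 ^ card A / fact (card A) = surj_coeff (card B) (card A)"
  using assms(2)
proof (induction B rule: finite_psubset_induct)
  case (psubset B)
  let ?m = "card A" and ?g = "\<lambda>j. surj_coeff j (card A)"
  let ?f = "\<lambda>C. of_nat (card (surjections A C)) * ln 2 ^ card A / fact (card A) :: complex"
  have "(\<Sum>C\<in>Pow B. ?f C) = of_nat (\<Sum>C\<in>Pow B. card (surjections A C)) * ln 2 ^ card A / fact (card A)"
    by (simp only: sum_distrib_right[symmetric] sum_divide_distrib[symmetric] of_nat_sum)
  also have "\<dots> = (of_nat (card B) * ln 2) ^ card A / fact (card A)"
    using assms psubset by (simp add: sum_card_surjections power_mult_distrib)
  also have "\<dots> = (\<Sum>C\<in>Pow B. ?g (card C))"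
    unfolding sum_Pow_card[OF psubset.hyps, where g = ?g] surj_coeff_binomial ..
  finally have "(\<Sum>C\<in>Pow B. ?f C) = (\<Sum>C\<in>Pow B. ?g (card C))" .
  moreover have "Pow B = insert B (Pow B - {B})" by auto
  moreover have "(\<Sum>C\<in>Pow B - {B}. ?f C) = (\<Sum>C\<in>Pow B - {B}. ?g (card C))"
    using psubset.IH by (intro sum.cong) auto
  ultimately show ?case
    using psubset.hyps by (simp add: sum.remove[of "Pow B" B])
qed

definition num_surj :: "nat \<Rightarrow> nat \<Rightarrow> nat" where
  "num_surj m k = card (surjections {..<m} {..<k})"

lemma num_surj_fourier: "real (num_surj m k) * ln 2 ^ m / fact m = norm (surj_coeff k m)"
proof -
  have l: "(ln 2 :: complex) = of_real (ln 2)" using Ln_of_real[of 2] by simp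
  have "norm (surj_coeff k m) = norm (of_nat (num_surj m k) * (ln 2 :: complex) ^ m / fact m)"
    using card_surjections_fourier[of "{..<m}" "{..<k}"] by (simp add: num_surj_def)
  also have "\<dots> = real (num_surj m k) * ln 2 ^ m / fact m"
    unfolding l by (simp add: norm_mult norm_divide norm_power)
  finally show ?thesis ..
qed

text \<open>The coefficient depends on the two cardinalities only, so invariance under relabelling
  needs no transport along bijections.\<close>

lemma card_surjections:
  assumes "finite A" "finite B"
  shows "card (surjections A B) = num_surj (card A) (card B)"
proof -
  have "of_nat (card (surjections A B)) * (ln 2 :: complex) ^ card A / fact (card A) = of_nat (num_surj (card A) (card B)) * ln 2 ^ card A / fact (card A)"
    using card_surjections_fourier[OF assms] card_surjections_fourier[of "{..<card A}" "{..<card B}"]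
    by (simp add: num_surj_def)
  then show ?thesis by simp
qed

lemma sum_surj_limit:
  "(\<lambda>m. (real m)\<^sup>2 * (\<Sum>k=1..m. norm (surj_coeff k m) ^ 3 / real k)) \<longlonglongrightarrow> 1 / (2 * pi * sqrt 3 * (1 - ln 2))"
proof -
  define \<mu> where "\<mu> = 2 * ln (2::real)"
  define v where "v = 2 * ln 2 * (1 - ln 2 :: real)"
  define q where "q k m = norm (surj_coeff k m)" for k m
  obtain C where C: "\<And>k m. sqrt (real k) * q k m \<le> C"
    using surj_coeff_bound unfolding q_def by metis
  obtain D where D: "\<And>k m. \<bar>real m - \<mu> * real k\<bar> * q k m \<le> D"
    using surj_coeff_decay unfolding q_def \<mu>_def by metis
  have \<mu>: "\<mu> > 1" "\<mu> < 2" "\<mu> > 0" using ln2_ge_two_thirds ln_2_less_1 by (auto simp: \<mu>_def)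
  have v: "v > 0" using ln_2_less_1 by (simp add: v_def)
  have q: "q k m \<ge> 0" for k m by (simp add: q_def)
  have small: "(\<lambda>m. (real m)\<^sup>2 * (\<Sum>k | 1 \<le> k \<and> k \<le> m \<and> 2 * \<mu> * real k \<le> real m. q k m ^ 3 / real k)) \<longlonglongrightarrow> 0"
    by (rule small_part_limit[OF q \<mu>(3) D])
  have large: "(\<lambda>m. (real m)\<^sup>2 * (\<Sum>k | 1 \<le> k \<and> k \<le> m \<and> \<not> 2 * \<mu> * real k \<le> real m. q k m ^ 3 / real k))
     \<longlonglongrightarrow> \<mu> / (2 * pi * v * sqrt 3)"
    by (rule large_part_limit[OF q \<mu>(1,2) v C D])
       (unfold q_def v_def \<mu>_def, rule surj_coeff_limit)
  have split: "(\<Sum>k=1..m. q k m ^ 3 / real k) = (\<Sum>k | 1 \<le> k \<and> k \<le> m \<and> 2 * \<mu> * real k \<le> real m. q k m ^ 3 / real k)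
     + (\<Sum>k | 1 \<le> k \<and> k \<le> m \<and> \<not> 2 * \<mu> * real k \<le> real m. q k m ^ 3 / real k)" for m
    by (subst sum.union_disjoint[symmetric]) (auto intro!: sum.cong)
  have "\<mu> / (2 * pi * v * sqrt 3) = 1 / (2 * pi * sqrt 3 * (1 - ln 2))"
    using ln_2_less_1 by (simp add: \<mu>_def v_def)
  then show ?thesis
    using tendsto_add[OF small large] unfolding q_def[symmetric] split
    by (simp add: distrib_left)
qed

text \<open>In s(3m) / s(m)^3 the exponentials and the powers m^(3m) cancel. What is left is 27^m =
  3^(3m), powers of m, and a factor 1 / sqrt 3 that the extra sqrt 3 removes; (3m)! = 3m (3m - 1)!
  supplies the last power of m.\<close>

lemma fact_ratio_limit:
  "(\<lambda>m. 27 ^ m * fact m ^ 3 / ((real m)\<^sup>2 * fact (3 * m - 1))) \<longlonglongrightarrow> 2 * pi * sqrt 3"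
proof -
  define s where "s k = sqrt (real k) * real k ^ k * exp (- real k) / fact k" for k
  have s: "s \<longlonglongrightarrow> 1 / sqrt (2 * pi)" unfolding s_def by (rule stirling)
  have "filterlim (\<lambda>m::nat. 3 * m) at_top sequentially"
    by (rule filterlim_subseq) (simp add: strict_mono_def)
  then have s3: "(\<lambda>m. s (3 * m)) \<longlonglongrightarrow> 1 / sqrt (2 * pi)"
    by (rule filterlim_compose[OF s])
  have "(\<lambda>m. sqrt 3 * (s (3 * m) / s m ^ 3)) \<longlonglongrightarrow> sqrt 3 * (1 / sqrt (2 * pi) / (1 / sqrt (2 * pi)) ^ 3)"
    by (rule tendsto_mult[OF tendsto_const tendsto_divide[OF s3 tendsto_power[OF s]]]) simp
  also have "sqrt 3 * (1 / sqrt (2 * pi) / (1 / sqrt (2 * pi)) ^ 3) = 2 * pi * sqrt 3"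
  proof -
    define w where "w = sqrt (2 * pi)"
    have w: "w > 0" "w * w = 2 * pi" by (auto simp: w_def)
    have "1 / w / (1 / w) ^ 3 = w * w" using w(1) by (simp add: power3_eq_cube field_simps)
    then show ?thesis unfolding w_def[symmetric] w by simp
  qed
  finally have lim: "(\<lambda>m. sqrt 3 * (s (3 * m) / s m ^ 3)) \<longlonglongrightarrow> 2 * pi * sqrt 3" .
  show ?thesis
  proof (rule Lim_transform_eventually[OF lim])
    show "eventually (\<lambda>m. sqrt 3 * (s (3 * m) / s m ^ 3) = 27 ^ m * fact m ^ 3 / ((real m)\<^sup>2 * fact (3 * m - 1))) sequentially"
      using eventually_gt_at_top[of 0]
    proof eventually_elim
      case (elim m)
      have f: "fact (3 * m) = 3 * real m * fact (3 * m - 1)"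
        using elim fact_reduce[of "3 * m", where 'a = real] by simp
      have p: "real (3 * m) ^ (3 * m) = 27 ^ m * (real m ^ m) ^ 3"
      proof -
        have "(real m ^ m) ^ 3 = real m ^ (3 * m)" by (simp only: power_mult[symmetric] mult.commute)
        moreover have "(27 :: real) ^ m = 3 ^ (3 * m)" by (simp add: power_mult)
        ultimately show ?thesis by (simp only: of_nat_mult of_nat_numeral power_mult_distrib)
      qed
      have e: "exp (- real (3 * m)) = exp (- real m) ^ 3"
        by (simp add: exp_of_nat_mult[symmetric])
      have c: "sqrt (real m) ^ 3 = real m * sqrt (real m)" by (simp add: power3_eq_cube)
      have r: "sqrt (real (3 * m)) = sqrt 3 * sqrt (real m)" by (simp add: real_sqrt_mult)
      define a b where "a = real m ^ m" and "b = exp (- real m)"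
      have ab: "a > 0" "b > 0" using elim by (auto simp: a_def b_def)
      define t :: real where "t = sqrt 3"
      have e1: "s m ^ 3 = real m * sqrt (real m) * a ^ 3 * b ^ 3 / fact m ^ 3"
        by (simp add: s_def a_def b_def power_mult_distrib power_divide c)
      have e2: "s (3 * m) = t * sqrt (real m) * (27 ^ m * a ^ 3) * b ^ 3 / (3 * real m * fact (3 * m - 1))"
        by (simp only: s_def a_def b_def f p e r t_def)
      have "t * (s (3 * m) / s m ^ 3) = (t * t) * 27 ^ m * fact m ^ 3 / (3 * (real m)\<^sup>2 * fact (3 * m - 1))"
        unfolding e1 e2 using ab elim by (simp add: power2_eq_square mult_ac)
      moreover have "t * t = 3" by (simp add: t_def)
      ultimately show ?case by (simp add: t_def)
    qed
  qed
qed

text \<open>The 27^m of the factorial quotient is the 3^(3m) in (3 ln 2)^(3m); the power (ln 2)^(3m)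
  is the normalisation of the three coefficients.\<close>

lemma surjection_sum_asymptotics:
  "(\<lambda>m. (\<Sum>k=1..m. real (num_surj m k) ^ 3 / real k) / (1 / (1 - ln 2) * (fact (3 * m - 1) / (3 * ln 2) ^ (3 * m)))) \<longlonglongrightarrow> 1"
proof -
  define S where "S m = (\<Sum>k=1..m. norm (surj_coeff k m) ^ 3 / real k)" for m
  define R where "R m = 27 ^ m * fact m ^ 3 / ((real m)\<^sup>2 * fact (3 * m - 1))" for m
  have l: "1 - ln 2 > (0::real)" using ln_2_less_1 by simp
  have "(\<lambda>m. (1 - ln 2) * (R m * ((real m)\<^sup>2 * S m))) \<longlonglongrightarrow> (1 - ln 2) * ((2 * pi * sqrt 3) * (1 / (2 * pi * sqrt 3 * (1 - ln 2))))"
    unfolding R_def S_def by (rule tendsto_mult[OF tendsto_const tendsto_mult[OF fact_ratio_limit sum_surj_limit]])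
  also have "(1 - ln 2) * ((2 * pi * sqrt 3) * (1 / (2 * pi * sqrt 3 * (1 - ln 2)))) = (1::real)"
    using l by simp
  finally show ?thesis
  proof (rule Lim_transform_eventually)
    show "eventually (\<lambda>m. (1 - ln 2) * (R m * ((real m)\<^sup>2 * S m)) =
       (\<Sum>k=1..m. real (num_surj m k) ^ 3 / real k) / (1 / (1 - ln 2) * (fact (3 * m - 1) / (3 * ln 2) ^ (3 * m)))) sequentially"
      using eventually_gt_at_top[of 0]
    proof eventually_elim
      case (elim m)
      define L where "L = (ln 2 :: real) ^ m"
      have L: "L > 0" by (simp add: L_def)
      have "S m = (\<Sum>k=1..m. (L / fact m) ^ 3 * (real (num_surj m k) ^ 3 / real k))"
        unfolding S_def num_surj_fourier[symmetric] L_def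
        by (intro sum.cong) (simp_all add: power_mult_distrib power_divide)
      then have S: "S m = (L / fact m) ^ 3 * (\<Sum>k=1..m. real (num_surj m k) ^ 3 / real k)"
        by (simp only: sum_distrib_left)
      have "(3 * ln 2 :: real) ^ (3 * m) = 27 ^ m * L ^ 3"
      proof -
        have "L ^ 3 = ln 2 ^ (3 * m)" by (simp only: L_def power_mult[symmetric] mult.commute)
        moreover have "(27 :: real) ^ m = 3 ^ (3 * m)" by (simp add: power_mult)
        ultimately show ?thesis by (simp only: power_mult_distrib)
      qed
      then show ?case unfolding S R_def using L elim l
        by (simp add: power_divide)
    qed
  qed
qed

section \<open>Hamilton cycles as cyclic sequences of blocks\<close>

definition cyc_arcs :: "'a list \<Rightarrow> 'a rel" where
  "cyc_arcs vs = set (zip vs (rotate1 vs))"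

lemma cyc_arcs_conv: "cyc_arcs vs = (\<lambda>i. (vs ! i, vs ! (Suc i mod length vs))) ` {..<length vs}"
  by (auto simp: cyc_arcs_def set_zip nth_rotate1 image_iff) 

lemma fst_cyc_arcs: "fst ` cyc_arcs vs = set vs"
  by (auto simp: cyc_arcs_conv image_image set_conv_nth)

lemma rotate1_zip: "length xs = length ys \<Longrightarrow> rotate1 (zip xs ys) = zip (rotate1 xs) (rotate1 ys)"
  by (cases xs; cases ys) auto

lemma cyc_arcs_rotate: "cyc_arcs (rotate k vs) = cyc_arcs vs"
proof -
  have "cyc_arcs (rotate1 vs) = cyc_arcs vs" for vs :: "'a list"
    unfolding cyc_arcs_def by (subst rotate1_zip[symmetric]) auto
  then show ?thesis by (induction k) (simp_all add: rotate_def)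
qed

lemma pcas_map: "pcas u p v \<Longrightarrow> map fst p @ [v] = u # map snd p"
  by (induction u p v rule: pcas.induct) auto

lemma pawalk_verts_map: "pcas u p v \<Longrightarrow> pawalk_verts u p = u # map snd p"
  by (induction u p v rule: pcas.induct) auto

lemma pcas_zip: "pcas w (zip (w # xs) (xs @ [u])) u"
  by (induction xs arbitrary: w) auto

text \<open>For a closed walk p the heads of the arcs are the tails rotated by one place, so p is
  recovered by zipping \<open>map fst p\<close> with its rotation. The distinctness demanded of p
  concerns the heads and passes to the tails through this rotation.\<close>

lemma hamilton_cycles_conv:
  "hamilton_cycles G = cyc_arcs ` {vs. vs \<noteq> [] \<and> distinct vs \<and> set vs = pverts G \<and> cyc_arcs vs \<subseteq> parcs G}"
proof (intro equalityI subsetI)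
  fix c assume "c \<in> hamilton_cycles G"
  then obtain p u where p: "c = set p" "fst ` set p = pverts G" "p \<noteq> []"
    "set p \<subseteq> parcs G" "pcas u p u" "distinct (tl (pawalk_verts u p))"
    by (auto simp: hamilton_cycles_def pre_digraph.cycle_def pre_digraph.awalk_def
        cas_with_proj_eq awalk_verts_with_proj_eq)
  define vs where "vs = map fst p"
  have m: "vs @ [u] = u # map snd p" using pcas_map[OF p(5)] by (simp add: vs_def)
  have ne: "vs \<noteq> []" using p by (simp add: vs_def)
  then obtain xs where xs: "vs = u # xs" using m by (cases vs) auto
  then have rot: "rotate1 vs = map snd p" using m by simp
  then have "zip vs (rotate1 vs) = p" by (simp add: vs_def zip_map_fst_snd)
  then have r: "cyc_arcs vs = set p" by (simp add: cyc_arcs_def)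
  have "distinct (rotate1 vs)" using p(6) unfolding rot pawalk_verts_map[OF p(5)] by simp
  then show "c \<in> cyc_arcs ` {vs. vs \<noteq> [] \<and> distinct vs \<and> set vs = pverts G \<and> cyc_arcs vs \<subseteq> parcs G}"
    using p r ne by (intro image_eqI[of _ _ vs]) (auto simp: vs_def)
next
  fix c assume "c \<in> cyc_arcs ` {vs. vs \<noteq> [] \<and> distinct vs \<and> set vs = pverts G \<and> cyc_arcs vs \<subseteq> parcs G}"
  then obtain vs where vs: "c = cyc_arcs vs" "vs \<noteq> []" "distinct vs" "set vs = pverts G" "cyc_arcs vs \<subseteq> parcs G"
    by auto
  then obtain u xs where xs: "vs = u # xs" by (cases vs) auto
  define p where "p = zip vs (rotate1 vs)"
  have pc: "pcas u p u" unfolding p_def xs using pcas_zip[of u xs u] by simp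
  have "map snd p = rotate1 vs" by (simp add: p_def)
  then have "distinct (tl (pawalk_verts u p))" using vs(3) unfolding pawalk_verts_map[OF pc] by simp
  moreover have "p \<noteq> []" by (simp add: p_def xs)
  moreover have "fst ` set p = pverts G" using fst_cyc_arcs[of vs] vs by (simp add: p_def cyc_arcs_def)
  ultimately show "c \<in> hamilton_cycles G"
    using vs xs pc unfolding hamilton_cycles_def pre_digraph.cycle_def pre_digraph.awalk_def
        cas_with_proj_eq awalk_verts_with_proj_eq
    by (intro CollectI exI[of _ p]) (auto simp: p_def cyc_arcs_def)
qed

text \<open>If the heads differed, each would precede the other, against asymmetry. Later it shows
  that a rooted listing is determined by its blocks.\<close>

lemma sorted_wrt_unique:
  assumes "sorted_wrt P xs" "sorted_wrt P ys" "set xs = set ys"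
    and "\<And>x y. x \<in> set xs \<Longrightarrow> y \<in> set xs \<Longrightarrow> P x y \<Longrightarrow> \<not> P y x"
  shows "xs = ys"
  using assms
proof (induction xs arbitrary: ys)
  case (Cons x xs)
  obtain y zs where ys: "ys = y # zs" using Cons.prems(3) by (cases ys) auto
  have irr: "\<not> P z z" if "z \<in> set (x # xs)" for z using Cons.prems(4)[OF that that] by blast
  have "x = y"
  proof (rule ccontr)
    assume "x \<noteq> y"
    then have "x \<in> set zs" "y \<in> set xs" using Cons.prems(3) ys by auto
    then have "P y x" "P x y" using Cons.prems(1,2) ys by auto
    then show False using Cons.prems(4)[of x y] \<open>y \<in> set xs\<close> by simp
  qed
  moreover have "x \<notin> set xs" using Cons.prems(1) irr[of x] by auto
  moreover have "y \<notin> set zs" using Cons.prems(2,3) irr[of y] ys by auto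
  ultimately have "set xs = set zs" using Cons.prems(3) ys by auto
  moreover have "sorted_wrt P xs" "sorted_wrt P zs" using Cons.prems(1,2) ys by auto
  ultimately have "xs = zs" using Cons.prems(4) by (intro Cons.IH) simp_all
  then show ?case using ys \<open>x = y\<close> by simp
qed simp

text \<open>Insertion of a: elements below a go before it, all others after it by totality, and
  transitivity through a orders the two groups.\<close>

lemma sorted_wrt_exists:
  assumes "finite A" "\<And>x y z. \<lbrakk>x \<in> A; y \<in> A; z \<in> A; P x y; P y z\<rbrakk> \<Longrightarrow> P x z"
    and "\<And>x y. \<lbrakk>x \<in> A; y \<in> A; x \<noteq> y\<rbrakk> \<Longrightarrow> P x y \<or> P y x"
  shows "\<exists>xs. set xs = A \<and> distinct xs \<and> sorted_wrt P xs"
  using assms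
proof (induction A rule: finite_induct)
  case (insert a A)
  have "\<exists>xs. set xs = A \<and> distinct xs \<and> sorted_wrt P xs"
  proof (rule insert.IH)
    show "P x z" if "x \<in> A" "y \<in> A" "z \<in> A" "P x y" "P y z" for x y z
      using that by (intro insert.prems(1)[of x y z]) simp_all
    show "P x y \<or> P y x" if "x \<in> A" "y \<in> A" "x \<noteq> y" for x y
      using that by (intro insert.prems(2)) simp_all
  qed
  then obtain xs where xs: "set xs = A" "distinct xs" "sorted_wrt P xs" by blast
  let ?l = "filter (\<lambda>x. P x a) xs" and ?r = "filter (\<lambda>x. \<not> P x a) xs"
  have "sorted_wrt P (?l @ a # ?r)"
  proof -
    have r: "P a y" if "y \<in> set ?r" for y
      using that xs insert.hyps insert.prems(2)[of a y] by auto
    have l: "P x y" if "x \<in> set ?l" "y \<in> set ?r" for x y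
      using that xs r[OF that(2)] insert.prems(1)[of x a y] by simp
    have "sorted_wrt P (a # ?r)"
      unfolding sorted_wrt.simps using r sorted_wrt_filter[OF xs(3)] by blast
    moreover have "\<forall>x\<in>set ?l. \<forall>y\<in>set (a # ?r). P x y"
    proof (intro ballI)
      fix x y assume "x \<in> set ?l" "y \<in> set (a # ?r)"
      then show "P x y" using l[of x y] by (cases "y = a") auto
    qed
    ultimately show ?thesis
      unfolding sorted_wrt_append using sorted_wrt_filter[OF xs(3)] by blast
  qed
  moreover have "set (?l @ a # ?r) = insert a A" using xs by auto
  moreover have "distinct (?l @ a # ?r)" using xs insert.hyps by auto
  ultimately show ?case by blast
qed auto

section \<open>Cycles cut open at a crossing arc\<close>

text \<open>What the count uses of \<open>C3\<close>: parts are residues modulo 3, arcs between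
  parts go from a residue to its successor, and arcs inside a part form a strict linear order.
  \<open>ty_surj\<close> keeps all parts nonempty, without which a cycle need not cross from part 2
  to part 0.\<close>

locale cyclic_blocks =
  fixes V :: "'a set" and ty :: "'a \<Rightarrow> nat" and lt :: "'a \<Rightarrow> 'a \<Rightarrow> bool" and R :: "'a rel"
  assumes fin: "finite V"
    and ty_less: "v \<in> V \<Longrightarrow> ty v < 3"
    and ty_surj: "i < 3 \<Longrightarrow> \<exists>v\<in>V. ty v = i"
    and lt_irrefl: "v \<in> V \<Longrightarrow> \<not> lt v v"
    and lt_trans: "\<lbrakk>u \<in> V; v \<in> V; w \<in> V; ty u = ty v; ty v = ty w; lt u v; lt v w\<rbrakk> \<Longrightarrow> lt u w"
    and lt_total: "\<lbrakk>u \<in> V; v \<in> V; ty u = ty v; u \<noteq> v\<rbrakk> \<Longrightarrow> lt u v \<or> lt v u"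
    and R_iff: "\<lbrakk>u \<in> V; v \<in> V\<rbrakk> \<Longrightarrow> (u, v) \<in> R \<longleftrightarrow> (ty u = ty v \<and> lt u v) \<or> ty v = Suc (ty u) mod 3"
begin

definition seqs :: "'a list set" where
  "seqs = {vs. vs \<noteq> [] \<and> distinct vs \<and> set vs = V \<and> cyc_arcs vs \<subseteq> R}"

definition crossing :: "'a rel \<Rightarrow> 'a rel" where
  "crossing c = {e \<in> c. ty (fst e) = 2 \<and> ty (snd e) = 0}"

text \<open>Listings cut open at a crossing arc: the arc closing the cycle, from
  \<open>last vs\<close> to \<open>hd vs\<close>, is the cut one.\<close>

definition rooted :: "'a list set" where
  "rooted = {vs \<in> seqs. ty (hd vs) = 0 \<and> ty (last vs) = 2}"

lemma seqs_length: "vs \<in> seqs \<Longrightarrow> length vs = card V"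
  by (auto simp: seqs_def distinct_card)

lemma V_ne: "V \<noteq> {}" using ty_surj[of 0] by auto

lemma seqs_nth: "vs \<in> seqs \<Longrightarrow> i < card V \<Longrightarrow> vs ! i \<in> V"
  using seqs_length[of vs] by (auto simp: seqs_def)

lemma cardV_pos: "card V > 0" using V_ne fin by (simp add: card_gt_0_iff)

lemma seqs_arc:
  assumes "vs \<in> seqs" "i < card V"
  shows "(vs ! i, vs ! (Suc i mod card V)) \<in> R"
  using assms seqs_length[OF assms(1)] by (auto simp: seqs_def cyc_arcs_conv)

text \<open>On a cycle every vertex has one successor, so the first vertex determines the
  listing.\<close>

lemma seqs_eqI:
  assumes "vs \<in> seqs" "ws \<in> seqs" "cyc_arcs vs = cyc_arcs ws" "hd vs = hd ws"
  shows "vs = ws"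
proof -
  let ?n = "card V"
  have l: "length vs = ?n" "length ws = ?n" using assms seqs_length by auto
  have "vs ! i = ws ! i" if "i < ?n" for i
    using that
  proof (induction i)
    case 0
    then show ?case using assms by (simp add: seqs_def hd_conv_nth)
  next
    case (Suc i)
    have "(vs ! i, vs ! (Suc i mod ?n)) \<in> cyc_arcs ws"
    proof -
      have "(vs ! i, vs ! (Suc i mod ?n)) \<in> cyc_arcs vs"
        using Suc.prems l unfolding cyc_arcs_conv by (intro image_eqI[of _ _ i]) auto
      then show ?thesis unfolding assms(3) .
    qed
    then obtain j where j: "j < ?n" "vs ! i = ws ! j" "vs ! (Suc i mod ?n) = ws ! (Suc j mod ?n)"
      using l by (auto simp: cyc_arcs_conv)
    then have "ws ! j = ws ! i" using Suc by simp
    then have "j = i" using assms(2) l j(1) Suc.prems by (simp add: seqs_def nth_eq_iff_index_eq)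
    then show ?case using j Suc.prems by simp
  qed
  then show ?thesis using l by (intro nth_equalityI) auto
qed

lemma seqs_rotate: "vs \<in> seqs \<Longrightarrow> rotate k vs \<in> seqs"
  by (auto simp: seqs_def cyc_arcs_rotate)

text \<open>A rooted listing amounts to a cycle with one marked crossing arc. For surjectivity the
  listing is rotated until the marked arc joins the last vertex to the first.\<close>

lemma bij_betw_rooted:
  "bij_betw (\<lambda>vs. (cyc_arcs vs, (last vs, hd vs))) rooted (SIGMA c:cyc_arcs ` seqs. crossing c)"
proof (rule bij_betwI')
  fix vs ws assume "vs \<in> rooted" "ws \<in> rooted"
  then show "((cyc_arcs vs, last vs, hd vs) = (cyc_arcs ws, last ws, hd ws)) = (vs = ws)"
    using seqs_eqI[of vs ws] by (auto simp: rooted_def)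
next
  fix vs assume vs: "vs \<in> rooted"
  then have s: "vs \<in> seqs" by (simp add: rooted_def)
  have "(last vs, hd vs) \<in> cyc_arcs vs"
    unfolding cyc_arcs_conv using s cardV_pos seqs_length[OF s]
    by (intro image_eqI[of _ _ "card V - 1"]) (auto simp: seqs_def last_conv_nth hd_conv_nth)
  then show "(cyc_arcs vs, last vs, hd vs) \<in> (SIGMA c:cyc_arcs ` seqs. crossing c)"
    using vs by (auto simp: rooted_def crossing_def)
next
  fix ce assume "ce \<in> (SIGMA c:cyc_arcs ` seqs. crossing c)"
  then obtain vs e where vs: "vs \<in> seqs" "ce = (cyc_arcs vs, e)" "e \<in> crossing (cyc_arcs vs)" by auto
  let ?n = "card V"
  have l: "length vs = ?n" using vs seqs_length by auto
  obtain i where i: "i < ?n" "e = (vs ! i, vs ! (Suc i mod ?n))"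
    using vs(3) l by (auto simp: crossing_def cyc_arcs_conv)
  define ws where "ws = rotate (Suc i) vs"
  have ws: "ws \<in> seqs" unfolding ws_def using vs(1) by (rule seqs_rotate)
  have lw: "length ws = ?n" "ws \<noteq> []" using seqs_length[OF ws] ws by (auto simp: seqs_def)
  have hd: "hd ws = vs ! (Suc i mod ?n)"
    using lw cardV_pos l by (simp add: hd_conv_nth ws_def nth_rotate del: rotate_Suc)
  have "last ws = vs ! ((?n - 1 + Suc i) mod ?n)"
    using lw cardV_pos l by (simp add: last_conv_nth ws_def nth_rotate add.commute del: rotate_Suc)
  also have "(?n - 1 + Suc i) = i + ?n" using cardV_pos by simp
  finally have la: "last ws = vs ! i" using i by simp
  have "ws \<in> rooted" using vs(3) i ws hd la by (simp add: rooted_def crossing_def)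
  moreover have "ce = (cyc_arcs ws, last ws, hd ws)"
    unfolding hd la vs(2) i(2) by (simp add: ws_def cyc_arcs_rotate del: rotate_Suc)
  ultimately show "\<exists>ws\<in>rooted. ce = (cyc_arcs ws, last ws, hd ws)" by blast
qed

lemma finite_seqs: "finite seqs"
  by (rule finite_subset[OF _ finite_lists_length_eq[OF fin, of "card V"]])
    (auto simp: seqs_length, auto simp: seqs_def)

lemma finite_crossing: "vs \<in> seqs \<Longrightarrow> finite (crossing (cyc_arcs vs))"
  by (simp add: crossing_def cyc_arcs_def)

text \<open>A cycle with k crossing arcs can be cut in k ways; this is the source of the weight 1 /
  k.\<close>

lemma card_rooted:
  "card {vs \<in> rooted. card (crossing (cyc_arcs vs)) = k}
     = k * card {c \<in> cyc_arcs ` seqs. card (crossing c) = k}"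
proof -
  let ?H = "{c \<in> cyc_arcs ` seqs. card (crossing c) = k}"
  have "bij_betw (\<lambda>vs. (cyc_arcs vs, (last vs, hd vs))) {vs \<in> rooted. card (crossing (cyc_arcs vs)) = k} (SIGMA c:?H. crossing c)"
  proof (rule bij_betw_subset[OF bij_betw_rooted])
    show "(\<lambda>vs. (cyc_arcs vs, (last vs, hd vs))) ` {vs \<in> rooted. card (crossing (cyc_arcs vs)) = k} = (SIGMA c:?H. crossing c)"
      (is "?f ` ?A = ?B")
    proof (intro equalityI subsetI)
      fix x assume "x \<in> ?f ` ?A"
      then obtain vs where vs: "vs \<in> ?A" "x = ?f vs" by blast
      then have "?f vs \<in> (SIGMA c:cyc_arcs ` seqs. crossing c)" using bij_betw_apply[OF bij_betw_rooted] by blast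
      then show "x \<in> ?B" using vs by auto
    next
      fix x assume x: "x \<in> ?B"
      then have "x \<in> (SIGMA c:cyc_arcs ` seqs. crossing c)" by auto
      then obtain vs where "vs \<in> rooted" "x = ?f vs"
        unfolding bij_betw_imp_surj_on[OF bij_betw_rooted, symmetric] by blast
      then show "x \<in> ?f ` ?A" using x by auto
    qed
  qed blast
  then have "card {vs \<in> rooted. card (crossing (cyc_arcs vs)) = k} = card (SIGMA c:?H. crossing c)"
    by (rule bij_betw_same_card)
  also have "\<dots> = (\<Sum>c\<in>?H. card (crossing c))"
    using finite_seqs finite_crossing by (intro card_SigmaI) auto
  finally show ?thesis by simp
qed

text \<open>Without a crossing arc the successor of a vertex of type 2 would again have type 2.\<close>
lemma card_crossing_pos:
  assumes "vs \<in> seqs" shows "card (crossing (cyc_arcs vs)) > 0"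
proof (rule ccontr)
  assume "\<not> card (crossing (cyc_arcs vs)) > 0"
  then have none: "crossing (cyc_arcs vs) = {}" using finite_crossing[OF assms] by simp
  let ?n = "card V"
  have l: "length vs = ?n" and s: "set vs = V" using assms seqs_length by (auto simp: seqs_def)
  have step: "ty (vs ! (Suc i mod ?n)) = 2" if "i < ?n" "ty (vs ! i) = 2" for i
  proof -
    have "(vs ! i, vs ! (Suc i mod ?n)) \<in> cyc_arcs vs" using that l by (auto simp: cyc_arcs_conv)
    then have "ty (vs ! (Suc i mod ?n)) \<noteq> 0" using none that by (force simp: crossing_def)
    moreover have "vs ! i \<in> V" "vs ! (Suc i mod ?n) \<in> V" using assms that cardV_pos by (auto intro!: seqs_nth)
    ultimately show ?thesis using seqs_arc[OF assms that(1)] that R_iff by auto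
  qed
  obtain u where "u \<in> V" "ty u = 2" using ty_surj[of 2] by auto
  then obtain i where i: "i < ?n" "ty (vs ! i) = 2" using s l by (metis in_set_conv_nth)
  have all: "ty (vs ! ((i + t) mod ?n)) = 2" for t
  proof (induction t)
    case (Suc t)
    then show ?case using step[of "(i + t) mod ?n"] cardV_pos by (simp add: mod_Suc_eq)
  qed (use i in simp)
  obtain w where "w \<in> V" "ty w = 0" using ty_surj[of 0] by auto
  then obtain j where j: "j < ?n" "ty (vs ! j) = 0" using s l by (metis in_set_conv_nth)
  have "(i + (j + ?n - i)) mod ?n = j" using i j by simp
  then show False using all[of "j + ?n - i"] j by simp
qed


section \<open>Encoding rooted listings by rounds and blocks\<close>

text \<open>Each change of part moves on to the next part. From a root in part 0, the level modulo 3
  is therefore the part, and the level divided by 3 counts the completed rounds.\<close>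

definition level :: "'a list \<Rightarrow> nat \<Rightarrow> nat" where
  "level vs i = card {j. j < i \<and> ty (vs ! j) \<noteq> ty (vs ! Suc j)}"

text \<open>
  \<open>F v\<close> encodes both the type of \<open>v\<close> and the round, counted from the root, in which the
  cycle visits \<open>v\<close>: it is three times the round plus the type.
\<close>
definition blocks :: "nat \<Rightarrow> ('a \<Rightarrow> nat) set" where
  "blocks k = {F \<in> V \<rightarrow>\<^sub>E {..<3 * k}. F ` V = {..<3 * k} \<and> (\<forall>v\<in>V. F v mod 3 = ty v)}"

text \<open>The order in which the cycle visits the vertices: by block, and inside a block along the
  transitive tournament.\<close>

definition block_order :: "('a \<Rightarrow> nat) \<Rightarrow> 'a \<Rightarrow> 'a \<Rightarrow> bool" where
  "block_order F u v \<longleftrightarrow> F u < F v \<or> (F u = F v \<and> lt u v)"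

definition block_map :: "'a list \<Rightarrow> 'a \<Rightarrow> nat" where
  "block_map vs = restrict (\<lambda>v. level vs (inv_into {..<card V} ((!) vs) v)) V"

lemma level_0 [simp]: "level vs 0 = 0"
  by (simp add: level_def)

lemma level_Suc: "level vs (Suc i) = level vs i + (if ty (vs ! i) = ty (vs ! Suc i) then 0 else 1)"
proof -
  have "{j. j < Suc i \<and> ty (vs ! j) \<noteq> ty (vs ! Suc j)}
    = (if ty (vs ! i) = ty (vs ! Suc i) then {} else {i}) \<union> {j. j < i \<and> ty (vs ! j) \<noteq> ty (vs ! Suc j)}"
    by (auto simp: less_Suc_eq)
  then show ?thesis by (simp add: level_def)
qed

lemma seqs_step:
  assumes "vs \<in> seqs" "Suc i < card V"
  shows "ty (vs ! i) = ty (vs ! Suc i) \<and> lt (vs ! i) (vs ! Suc i) \<or> ty (vs ! Suc i) = Suc (ty (vs ! i)) mod 3"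
proof -
  have "(vs ! i, vs ! Suc i) \<in> R" using seqs_arc[of vs i] assms by simp
  then show ?thesis using R_iff[of "vs ! i" "vs ! Suc i"] seqs_nth[OF assms(1)] assms(2) by simp
qed

lemma level_mod:
  assumes "vs \<in> rooted" "i < card V"
  shows "level vs i mod 3 = ty (vs ! i)"
  using assms(2)
proof (induction i)
  case 0
  then show ?case using assms(1) by (auto simp: rooted_def seqs_def hd_conv_nth)
next
  case (Suc i)
  have s: "vs \<in> seqs" using assms by (simp add: rooted_def)
  have IH: "level vs i mod 3 = ty (vs ! i)" using Suc by simp
  show ?case
  proof (cases "ty (vs ! i) = ty (vs ! Suc i)")
    case True then show ?thesis using IH by (simp add: level_Suc)
  next
    case False
    then have "ty (vs ! Suc i) = Suc (ty (vs ! i)) mod 3" using seqs_step[OF s Suc.prems] by simp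
    moreover have "Suc (level vs i) mod 3 = Suc (ty (vs ! i)) mod 3"
      using mod_Suc_eq[of "level vs i" 3] IH by simp
    ultimately show ?thesis using False by (simp add: level_Suc)
  qed
qed

text \<open>Inside the listing a crossing arc occurs exactly when the level reaches a positive
  multiple of 3; \<open>Suc\<close> accounts for the closing arc from the last to the first
  vertex.\<close>

lemma card_crossing_level:
  assumes "vs \<in> rooted"
  shows "card (crossing (cyc_arcs vs)) = Suc (level vs (card V - 1) div 3)"
proof -
  let ?n = "card V"
  have s: "vs \<in> seqs" using assms by (simp add: rooted_def)
  have l: "length vs = ?n" "distinct vs" "vs \<noteq> []" using s seqs_length by (auto simp: seqs_def)
  have ends: "ty (vs ! 0) = 0" "ty (vs ! (?n - 1)) = 2"
    using assms l by (auto simp: rooted_def hd_conv_nth last_conv_nth)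
  let ?I = "{i. i < ?n - 1 \<and> ty (vs ! i) = 2 \<and> ty (vs ! Suc i) = 0}"
  let ?f = "\<lambda>i. (vs ! i, vs ! (Suc i mod ?n))"
  have n: "?n > 0" by (rule cardV_pos)
  have "crossing (cyc_arcs vs) = ?f ` {i. i < ?n \<and> ty (vs ! i) = 2 \<and> ty (vs ! (Suc i mod ?n)) = 0}"
    using l by (auto simp: crossing_def cyc_arcs_conv)
  moreover have "{i. i < ?n \<and> ty (vs ! i) = 2 \<and> ty (vs ! (Suc i mod ?n)) = 0} = insert (?n - 1) ?I"
  proof (rule set_eqI)
    fix i
    show "i \<in> {i. i < ?n \<and> ty (vs ! i) = 2 \<and> ty (vs ! (Suc i mod ?n)) = 0} \<longleftrightarrow> i \<in> insert (?n - 1) ?I"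
    proof (cases "i = ?n - 1")
      case True
      then have "Suc i mod ?n = 0" using n by simp
      then show ?thesis using True n ends by simp
    next
      case False
      then have "i < ?n \<longleftrightarrow> i < ?n - 1" by linarith
      then show ?thesis using False by auto
    qed
  qed
  moreover have "inj_on ?f {..<?n}"
    using l by (auto simp: inj_on_def nth_eq_iff_index_eq)
  then have "inj_on ?f (insert (?n - 1) ?I)" by (rule inj_on_subset) (use n in auto)
  ultimately have "card (crossing (cyc_arcs vs)) = card (insert (?n - 1) ?I)" by (simp add: card_image)
  also have "\<dots> = Suc (card ?I)" by (simp add: card_insert_if)
  also have "card {i. i < t \<and> ty (vs ! i) = 2 \<and> ty (vs ! Suc i) = 0} = level vs t div 3" if "t < ?n" for t
    using that
  proof (induction t)
    case (Suc t)
    have IH: "card {i. i < t \<and> ty (vs ! i) = 2 \<and> ty (vs ! Suc i) = 0} = level vs t div 3" using Suc by simp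
    have m: "level vs t mod 3 = ty (vs ! t)" using level_mod[OF assms] Suc.prems by simp
    have "{i. i < Suc t \<and> ty (vs ! i) = 2 \<and> ty (vs ! Suc i) = 0}
      = (if ty (vs ! t) = 2 \<and> ty (vs ! Suc t) = 0 then {t} else {}) \<union> {i. i < t \<and> ty (vs ! i) = 2 \<and> ty (vs ! Suc i) = 0}"
      by (auto simp: less_Suc_eq)
    then have c: "card {i. i < Suc t \<and> ty (vs ! i) = 2 \<and> ty (vs ! Suc i) = 0}
      = (if ty (vs ! t) = 2 \<and> ty (vs ! Suc t) = 0 then 1 else 0) + level vs t div 3"
      using IH by simp
    have m': "level vs (Suc t) mod 3 = ty (vs ! Suc t)" using level_mod[OF assms] Suc.prems by simp
    show ?case
    proof (cases "ty (vs ! t) = ty (vs ! Suc t)")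
      case True then show ?thesis using c by (simp add: level_Suc)
    next
      case False
      then have L: "level vs (Suc t) = Suc (level vs t)" by (simp add: level_Suc)
      show ?thesis using c m m' unfolding L by (auto simp: div_Suc mod_Suc split: if_splits)
    qed
  qed simp
  from this[of "?n - 1"] have "card ?I = level vs (?n - 1) div 3" using n by simp
  finally show ?thesis .
qed

text \<open>The level grows by at most one per position, so it skips no value.\<close>

lemma level_surj: "level vs ` {..i} = {..level vs i}"
proof (induction i)
  case (Suc i)
  have "level vs ` {..Suc i} = insert (level vs (Suc i)) {..level vs i}"
    using Suc by (simp add: atMost_Suc)
  then show ?case by (auto simp: level_Suc)
qed simp

lemma block_map_nth:
  assumes "vs \<in> seqs" "i < card V"
  shows "block_map vs (vs ! i) = level vs i"
proof -
  have "inj_on ((!) vs) {..<card V}"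
    using assms seqs_length[OF assms(1)] by (auto simp: inj_on_def seqs_def nth_eq_iff_index_eq)
  then show ?thesis using assms seqs_nth by (simp add: block_map_def)
qed

lemma seqs_image: "vs \<in> seqs \<Longrightarrow> (!) vs ` {..<card V} = V"
  using seqs_length[of vs] by (auto simp: seqs_def set_conv_nth)

lemma seqs_index: "vs \<in> seqs \<Longrightarrow> v \<in> V \<Longrightarrow> \<exists>i<card V. v = vs ! i"
  using seqs_image[of vs] by (auto simp: image_iff)

text \<open>The last vertex has type 2, so the last round is complete and the levels fill {..<3 * k}
  exactly.\<close>

lemma block_map_in_blocks:
  assumes "vs \<in> rooted"
  shows "block_map vs \<in> blocks (card (crossing (cyc_arcs vs)))"
proof -
  let ?n = "card V"
  have s: "vs \<in> seqs" using assms by (simp add: rooted_def)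
  have "ty (vs ! (?n - 1)) = 2"
    using assms s seqs_length[OF s] by (auto simp: rooted_def seqs_def last_conv_nth)
  then have "level vs (?n - 1) mod 3 = 2" using level_mod[OF assms, of "?n - 1"] cardV_pos by simp
  then have k: "3 * card (crossing (cyc_arcs vs)) = Suc (level vs (?n - 1))"
    unfolding card_crossing_level[OF assms] by presburger
  have "block_map vs ` V = (\<lambda>i. block_map vs (vs ! i)) ` {..<?n}"
    by (subst seqs_image[OF s, symmetric]) (simp only: image_image)
  also have "\<dots> = level vs ` {..<?n}" using block_map_nth[OF s] by (intro image_cong) auto
  also have "{..<?n} = {..?n - 1}" using cardV_pos by auto
  also have "level vs ` {..?n - 1} = {..<3 * card (crossing (cyc_arcs vs))}"
    unfolding level_surj k by auto
  finally have im: "block_map vs ` V = {..<3 * card (crossing (cyc_arcs vs))}" .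
  moreover have "block_map vs v mod 3 = ty v" if v: "v \<in> V" for v
  proof -
    obtain i where "i < ?n" "v = vs ! i" using seqs_index[OF s v] by blast
    then show ?thesis using block_map_nth[OF s] level_mod[OF assms] by simp
  qed
  moreover have "block_map vs \<in> extensional V" by (simp add: block_map_def)
  ultimately show ?thesis by (auto simp: blocks_def PiE_iff)
qed

text \<open>Equal values of F have equal residues, hence equal types, and \<open>lt_trans\<close>
  applies; otherwise F decides.\<close>

lemma block_order_trans:
  assumes "F \<in> blocks k" "u \<in> V" "v \<in> V" "w \<in> V" "block_order F u v" "block_order F v w"
  shows "block_order F u w"
proof -
  have t: "F u mod 3 = ty u" "F v mod 3 = ty v" "F w mod 3 = ty w" using assms(1-4) by (simp_all add: blocks_def)
  show ?thesis
  proof (cases "F u = F v \<and> F v = F w")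
    case True
    then have "ty u = ty v" "ty v = ty w" using t by auto
    then show ?thesis using True assms(5,6) lt_trans[OF assms(2-4)] by (simp add: block_order_def)
  next
    case False
    then show ?thesis using assms(5,6) unfolding block_order_def by linarith
  qed
qed

lemma block_order_total:
  assumes "F \<in> blocks k" "u \<in> V" "v \<in> V" "u \<noteq> v"
  shows "block_order F u v \<or> block_order F v u"
proof -
  have "F u mod 3 = ty u" "F v mod 3 = ty v" using assms(1-3) by (simp_all add: blocks_def)
  then show ?thesis using lt_total[OF assms(2,3)] assms(4) unfolding block_order_def by (cases "F u" "F v" rule: linorder_cases) auto
qed

lemma block_order_asym:
  assumes "F \<in> blocks k" "u \<in> V" "v \<in> V" "block_order F u v"
  shows "\<not> block_order F v u"
proof
  assume "block_order F v u"
  then have "block_order F u u" using block_order_trans[OF assms(1-3,2,4)] by simp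
  then show False using lt_irrefl[OF assms(2)] by (simp add: block_order_def)
qed

lemma rooted_sorted:
  assumes "vs \<in> rooted"
  shows "sorted_wrt (block_order (block_map vs)) vs"
proof -
  have s: "vs \<in> seqs" using assms by (simp add: rooted_def)
  have l: "length vs = card V" by (rule seqs_length[OF s])
  have "block_order (block_map vs) (vs ! i) (vs ! j)" if "i < j" "j < card V" for i j
    using that
  proof (induction j)
    case (Suc j)
    have step: "block_order (block_map vs) (vs ! j) (vs ! Suc j)"
    proof -
      have "Suc t mod 3 \<noteq> t" for t :: nat by presburger
      then show ?thesis
        using seqs_step[OF s Suc.prems(2)] Suc.prems(2)
        by (simp add: block_order_def block_map_nth[OF s] level_Suc) metis
    qed
    show ?case
    proof (cases "i = j")
      case False
      then have "block_order (block_map vs) (vs ! i) (vs ! j)" using Suc by simp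
      moreover have "vs ! i \<in> V" "vs ! j \<in> V" "vs ! Suc j \<in> V" using Suc.prems by (auto intro!: seqs_nth[OF s])
      ultimately show ?thesis using step block_order_trans[OF block_map_in_blocks[OF assms]] by blast
    qed (use step in simp)
  qed simp
  then show ?thesis using l by (simp add: sorted_wrt_iff_nth_less)
qed

text \<open>The listing is recovered by sorting V along \<open>block_order\<close>.\<close>

lemma block_map_inj: "inj_on block_map rooted"
proof (rule inj_onI)
  fix vs ws assume vs: "vs \<in> rooted" "ws \<in> rooted" "block_map vs = block_map ws"
  have V: "set vs = V" "set ws = V" using vs by (auto simp: rooted_def seqs_def)
  show "vs = ws"
  proof (rule sorted_wrt_unique)
    show "sorted_wrt (block_order (block_map vs)) vs" "sorted_wrt (block_order (block_map vs)) ws"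
      using rooted_sorted[OF vs(1)] rooted_sorted[OF vs(2)] vs(3) by simp_all
    show "\<not> block_order (block_map vs) y x" if "x \<in> set vs" "y \<in> set vs" "block_order (block_map vs) x y" for x y
      using block_order_asym[OF block_map_in_blocks[OF vs(1)] _ _ that(3)] that V by simp
  qed (simp add: V)
qed

text \<open>Sort V along \<open>block_order F\<close>. As F takes every value below 3 k, consecutive
  vertices lie in the same or in adjacent blocks, and both cases are arcs; the levels of this
  listing then reproduce F.\<close>

lemma blocks_surj:
  assumes F: "F \<in> blocks k"
  shows "\<exists>vs\<in>rooted. block_map vs = F"
proof -
  let ?n = "card V"
  obtain vs where vs: "set vs = V" "distinct vs" "sorted_wrt (block_order F) vs"
    using sorted_wrt_exists[OF fin, of "block_order F"] block_order_trans[OF F] block_order_total[OF F] by blast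
  have l: "length vs = ?n" using vs distinct_card by metis
  have ne: "vs \<noteq> []" using vs V_ne by auto
  have n: "?n > 0" by (rule cardV_pos)
  have Fim: "F ` V = {..<3 * k}" and Fmod: "\<And>v. v \<in> V \<Longrightarrow> F v mod 3 = ty v" and Fext: "F \<in> extensional V"
    using F by (auto simp: blocks_def PiE_def)
  have k: "k > 0" using Fim V_ne by (cases k) auto
  have last_mod: "(3 * k - 1) mod 3 = 2" using k by (cases k) (simp_all add: mod_Suc)
  have inV: "vs ! i \<in> V" if "i < ?n" for i using that l vs by auto
  have ord: "block_order F (vs ! i) (vs ! j)" if "i < j" "j < ?n" for i j
    using that vs l by (simp add: sorted_wrt_iff_nth_less)
  have mono: "F (vs ! i) \<le> F (vs ! j)" if "i \<le> j" "j < ?n" for i j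
    using ord[of i j] that by (cases "i = j") (auto simp: block_order_def)
  have attain: "\<exists>i<?n. F (vs ! i) = w" if "w < 3 * k" for w
  proof -
    have "w \<in> F ` V" using that Fim by simp
    then obtain v where "v \<in> V" "F v = w" by auto
    then show ?thesis using vs l by (metis in_set_conv_nth)
  qed
  have lt3k: "F (vs ! i) < 3 * k" if "i < ?n" for i using Fim inV[OF that] by auto
  have F0: "F (vs ! 0) = 0"
  proof -
    obtain i where "i < ?n" "F (vs ! i) = 0" using attain[of 0] k by auto
    then show ?thesis using mono[of 0 i] by simp
  qed
  have Flast: "F (vs ! (?n - 1)) = 3 * k - 1"
  proof -
    obtain i where i: "i < ?n" "F (vs ! i) = 3 * k - 1" using attain[of "3 * k - 1"] k by auto
    then have "i \<le> ?n - 1" by linarith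
    from mono[OF this] have "3 * k - 1 \<le> F (vs ! (?n - 1))" using n i by simp
    moreover have "F (vs ! (?n - 1)) < 3 * k" using lt3k n by simp
    ultimately show ?thesis by linarith
  qed
  have step: "F (vs ! Suc i) = F (vs ! i) \<and> lt (vs ! i) (vs ! Suc i) \<or> F (vs ! Suc i) = Suc (F (vs ! i))"
    if Si: "Suc i < ?n" for i
  proof (rule ccontr)
    assume neg: "\<not> ?thesis"
    have "block_order F (vs ! i) (vs ! Suc i)" using ord Si by simp
    then have gap: "Suc (F (vs ! i)) < F (vs ! Suc i)" using neg by (auto simp: block_order_def)
    \<comment> \<open>A vertex carrying the skipped value could stand neither up to position i nor
      after it, by monotonicity.\<close>
    then obtain j where j: "j < ?n" "F (vs ! j) = Suc (F (vs ! i))"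
      using attain[of "Suc (F (vs ! i))"] lt3k[OF Si] by auto
    show False
    proof (cases "j \<le> i")
      case True then show False using mono[OF True] Si j by simp
    next
      case False then show False using mono[of "Suc i" j] j gap by simp
    qed
  qed
  have ty_eq: "ty (vs ! i) = F (vs ! i) mod 3" if "i < ?n" for i using Fmod[OF inV[OF that]] by simp
  have "(vs ! i, vs ! (Suc i mod ?n)) \<in> R" if i: "i < ?n" for i
  proof (cases "Suc i < ?n")
    case True
    then show ?thesis
      using step[OF True] R_iff[OF inV[OF i] inV[OF True]] ty_eq[OF i] ty_eq[OF True] by (auto simp: mod_Suc_eq)
  next
    case False
    \<comment> \<open>The closing arc leads from block 3 k - 1, of type 2, back to block 0, of type
      0.\<close>
    then have "i = ?n - 1" "Suc i mod ?n = 0" using i by (auto simp: le_Suc_eq not_less)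
    moreover have "(3 * k - 1) mod 3 = 2" by (rule last_mod)
    ultimately show ?thesis
      using R_iff[OF inV[OF i] inV[OF n]] ty_eq[OF i] ty_eq[OF n] F0 Flast by simp
  qed
  then have "vs \<in> seqs" using vs ne l by (auto simp: seqs_def cyc_arcs_conv)
  moreover have "ty (hd vs) = 0" "ty (last vs) = 2"
    using last_mod ty_eq[OF n] ty_eq[of "?n - 1"] n F0 Flast ne l
    by (simp_all add: hd_conv_nth last_conv_nth)
  ultimately have r: "vs \<in> rooted" by (simp add: rooted_def)
  have lev: "level vs i = F (vs ! i)" if "i < ?n" for i
    using that
  proof (induction i)
    case (Suc i)
    then have IH: "level vs i = F (vs ! i)" by simp
    have ne: "Suc (F (vs ! i)) mod 3 \<noteq> F (vs ! i) mod 3" by (simp add: mod_Suc)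
    have e: "ty (vs ! i) = F (vs ! i) mod 3" "ty (vs ! Suc i) = F (vs ! Suc i) mod 3"
      using ty_eq Suc.prems by simp_all
    from step[OF Suc.prems] consider "F (vs ! Suc i) = F (vs ! i)" | "F (vs ! Suc i) = Suc (F (vs ! i))" by blast
    then show ?case
    proof cases
      case 1
      then have "ty (vs ! i) = ty (vs ! Suc i)" using e by (simp only:)
      then show ?thesis using 1 IH by (simp add: level_Suc)
    next
      case 2
      then have "ty (vs ! i) \<noteq> ty (vs ! Suc i)" unfolding e 2 using ne by (simp only: not_sym)
      then show ?thesis using 2 IH by (simp add: level_Suc)
    qed
  qed (simp add: F0)
  have "block_map vs = F"
  proof (rule extensionalityI)
    show "block_map vs \<in> extensional V" by (simp add: block_map_def)
    fix v assume "v \<in> V"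
    then obtain i where "i < ?n" "v = vs ! i" using seqs_index[OF \<open>vs \<in> seqs\<close>] by blast
    then show "block_map vs v = F v" using block_map_nth[OF \<open>vs \<in> seqs\<close>] lev by simp
  qed (rule Fext)
  then show ?thesis using r by blast
qed

lemma card_rooted_blocks:
  "card {vs \<in> rooted. card (crossing (cyc_arcs vs)) = k} = card (blocks k)"
proof (rule bij_betw_same_card[of block_map], rule bij_betw_imageI)
  show "inj_on block_map {vs \<in> rooted. card (crossing (cyc_arcs vs)) = k}"
    by (rule inj_on_subset[OF block_map_inj]) auto
  show "block_map ` {vs \<in> rooted. card (crossing (cyc_arcs vs)) = k} = blocks k"
  proof (intro equalityI subsetI)
    fix F assume "F \<in> block_map ` {vs \<in> rooted. card (crossing (cyc_arcs vs)) = k}"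
    then show "F \<in> blocks k" using block_map_in_blocks by auto
  next
    fix F assume F: "F \<in> blocks k"
    then obtain vs where vs: "vs \<in> rooted" "block_map vs = F" using blocks_surj by blast
    let ?k = "card (crossing (cyc_arcs vs))"
    have "F ` V = {..<3 * ?k}" using block_map_in_blocks[OF vs(1)] vs(2) by (simp add: blocks_def)
    moreover have "F ` V = {..<3 * k}" using F by (simp add: blocks_def)
    ultimately have "?k = k" by simp
    then show "F \<in> block_map ` {vs \<in> rooted. card (crossing (cyc_arcs vs)) = k}" using vs by auto
  qed
qed


text \<open>The residue of \<open>F v\<close> is prescribed, so F is determined by the rounds
  \<open>F v div 3\<close>. That F meets all blocks means that on each part these rounds cover
  {..<k}, independently of the other parts.\<close>

lemma card_blocks:
  "card (blocks k) = (\<Prod>i<3. card (surjections {v \<in> V. ty v = i} {..<k}))"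
proof -
  let ?V = "\<lambda>i. {v \<in> V. ty v = i}"
  let ?P = "PiE {..<3} (\<lambda>i. surjections (?V i) {..<k})"
  define f where "f F = restrict (\<lambda>i. restrict (\<lambda>v. F v div 3) (?V i)) {..<3}" for F :: "'a \<Rightarrow> nat"
  define g where "g \<phi> = restrict (\<lambda>v. 3 * \<phi> (ty v) v + ty v) V" for \<phi> :: "nat \<Rightarrow> 'a \<Rightarrow> nat"
  have "bij_betw f (blocks k) ?P"
  proof (rule bij_betw_byWitness[where f' = g])
    show "\<forall>F\<in>blocks k. g (f F) = F"
    proof
      fix F assume F: "F \<in> blocks k"
      show "g (f F) = F"
      proof (rule extensionalityI[of _ V])
        fix v assume v: "v \<in> V"
        have "g (f F) v = 3 * (F v div 3) + ty v" using v ty_less[OF v] by (simp add: g_def f_def)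
        also have "ty v = F v mod 3" using F v by (simp add: blocks_def)
        finally show "g (f F) v = F v" by simp
      qed (use F in \<open>auto simp: g_def blocks_def PiE_def\<close>)
    qed
    show "\<forall>\<phi>\<in>?P. f (g \<phi>) = \<phi>"
    proof
      fix \<phi> assume \<phi>: "\<phi> \<in> ?P"
      show "f (g \<phi>) = \<phi>"
      proof (rule extensionalityI[of _ "{..<3}"])
        fix i :: nat assume i: "i \<in> {..<3}"
        then have \<phi>i: "\<phi> i \<in> surjections (?V i) {..<k}" using \<phi> by auto
        show "f (g \<phi>) i = \<phi> i"
        proof (rule extensionalityI[of _ "?V i"])
          fix v assume v: "v \<in> ?V i"
          then show "f (g \<phi>) i v = \<phi> i v" using i by (simp add: f_def g_def)
        qed (use \<phi>i i in \<open>auto simp: f_def surjections_def PiE_def\<close>)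
      qed (use \<phi> in \<open>auto simp: f_def PiE_def\<close>)
    qed
    show "f ` blocks k \<subseteq> ?P"
    proof (intro subsetI, elim imageE)
      fix \<phi> F assume F: "\<phi> = f F" "F \<in> blocks k"
      have im: "F ` V = {..<3 * k}" and md: "\<And>v. v \<in> V \<Longrightarrow> F v mod 3 = ty v" using F by (auto simp: blocks_def)
      have "f F i \<in> surjections (?V i) {..<k}" if i: "i < 3" for i
      proof -
        have fi: "f F i = restrict (\<lambda>v. F v div 3) (?V i)" using i by (simp add: f_def)
        have "(\<lambda>v. F v div 3) ` ?V i = {..<k}"
        proof (intro equalityI subsetI)
          fix w assume "w \<in> (\<lambda>v. F v div 3) ` ?V i"
          then obtain v where "v \<in> V" "w = F v div 3" by auto
          moreover then have "F v < 3 * k" using im by auto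
          ultimately show "w \<in> {..<k}" by auto
        next
          fix w assume "w \<in> {..<k}"
          then have "3 * w + i \<in> F ` V" unfolding im using i by simp
          then obtain v where v: "v \<in> V" "F v = 3 * w + i" by auto
          then have "ty v = i" "F v div 3 = w" using md[OF v(1)] i by simp_all
          then show "w \<in> (\<lambda>v. F v div 3) ` ?V i" using v(1) by (intro image_eqI[of _ _ v]) simp_all
        qed
        then show ?thesis unfolding fi surjections_def by auto
      qed
      then show "\<phi> \<in> ?P" unfolding F(1) by (auto simp: PiE_iff f_def)
    qed
    show "g ` ?P \<subseteq> blocks k"
    proof (intro subsetI, elim imageE)
      fix F \<phi> assume F: "F = g \<phi>" "\<phi> \<in> ?P"
      have im: "\<phi> i ` ?V i = {..<k}" if "i < 3" for i
        using F(2) that by (auto simp: PiE_iff surjections_def)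
      have val: "g \<phi> v = 3 * \<phi> (ty v) v + ty v" if "v \<in> V" for v using that by (simp add: g_def)
      have "g \<phi> ` V = {..<3 * k}"
      proof (intro equalityI subsetI)
        fix w assume "w \<in> g \<phi> ` V"
        then obtain v where v: "v \<in> V" "w = 3 * \<phi> (ty v) v + ty v" using val by auto
        have "\<phi> (ty v) v \<in> \<phi> (ty v) ` ?V (ty v)" using v by auto
        then have "\<phi> (ty v) v < k" using im[OF ty_less[OF v(1)]] by simp
        then show "w \<in> {..<3 * k}" using v ty_less[OF v(1)] by simp
      next
        fix w assume w: "w \<in> {..<3 * k}"
        then have "w div 3 \<in> {..<k}" by auto
        also have "{..<k} = \<phi> (w mod 3) ` ?V (w mod 3)" by (rule im[symmetric]) simp
        finally obtain v where v: "v \<in> V" "ty v = w mod 3" "w div 3 = \<phi> (w mod 3) v" by auto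
        have "g \<phi> v = 3 * (w div 3) + w mod 3" unfolding val[OF v(1)] v(2,3) ..
        then have "g \<phi> v = w" by simp
        then show "w \<in> g \<phi> ` V" using v(1) by auto
      qed
      moreover have "g \<phi> v mod 3 = ty v" if "v \<in> V" for v using val[OF that] ty_less[OF that] by simp
      moreover have "g \<phi> \<in> extensional V" by (simp add: g_def)
      ultimately show "F \<in> blocks k" unfolding F(1) blocks_def by (auto simp: PiE_iff)
    qed
  qed
  then have "card (blocks k) = card ?P" by (rule bij_betw_same_card)
  then show ?thesis by (simp add: card_PiE)
qed

text \<open>Cycles are grouped by their number k of crossing arcs. It is at least 1 by
  \<open>card_crossing_pos\<close>, and at most m because a nonempty class forces a surjection from
  m onto k elements.\<close>

lemma card_cycles:
  assumes m: "\<And>i. i < 3 \<Longrightarrow> card {v \<in> V. ty v = i} = m"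
  shows "real (card (cyc_arcs ` seqs)) = (\<Sum>k=1..m. real (num_surj m k) ^ 3 / real k)"
proof -
  let ?H = "\<lambda>k. {c \<in> cyc_arcs ` seqs. card (crossing c) = k}"
  have k: "k * card (?H k) = num_surj m k ^ 3" for k
  proof -
    have "k * card (?H k) = card (blocks k)" using card_rooted card_rooted_blocks by simp
    also have "\<dots> = (\<Prod>i<3::nat. num_surj m k)"
      unfolding card_blocks using m fin by (intro prod.cong) (simp_all add: card_surjections)
    finally show ?thesis by simp
  qed
  have "card (crossing c) \<in> {1..m}" if c: "c \<in> cyc_arcs ` seqs" for c
  proof -
    obtain vs where vs: "vs \<in> seqs" "c = cyc_arcs vs" using c by auto
    let ?k = "card (crossing c)"
    have pos: "?k > 0" using card_crossing_pos[OF vs(1)] vs(2) by simp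
    have "c \<in> ?H ?k" using c by simp
    then have "card (?H ?k) \<noteq> 0" using finite_seqs by (auto simp: card_eq_0_iff)
    then have "num_surj m ?k ^ 3 \<noteq> 0" unfolding k[of ?k, symmetric] using pos by simp
    then have "num_surj m ?k \<noteq> 0" by (rule contrapos_nn) simp
    then have "surjections {..<m} {..<?k} \<noteq> {}" by (auto simp: num_surj_def)
    then obtain \<phi> where "\<phi> ` {..<m} = {..<?k}" by (auto simp: surjections_def)
    then have "?k \<le> m" using card_image_le[of "{..<m}" \<phi>] by simp
    then show ?thesis using pos by simp
  qed
  then have "(\<Sum>c\<in>cyc_arcs ` seqs. 1::nat) = (\<Sum>k=1..m. \<Sum>c\<in>?H k. 1)"
    using finite_seqs by (intro sum.group[symmetric]) auto
  then have "card (cyc_arcs ` seqs) = (\<Sum>k=1..m. card (?H k))" by simp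
  then have "real (card (cyc_arcs ` seqs)) = (\<Sum>k=1..m. real (card (?H k)))" by simp
  also have "\<dots> = (\<Sum>k=1..m. real (num_surj m k) ^ 3 / real k)"
  proof (rule sum.cong)
    fix j assume "j \<in> {1..m}"
    moreover have "real j * real (card (?H j)) = real (num_surj m j) ^ 3"
      unfolding of_nat_mult[symmetric] of_nat_power[symmetric] k ..
    ultimately show "real (card (?H j)) = real (num_surj m j) ^ 3 / real j" by (simp add: field_simps)
  qed simp
  finally show ?thesis .
qed

end

section \<open>Back to tournaments\<close>

text \<open>Otherwise the arc from w to u would close a directed triangle.\<close>

lemma (in transitive_tournament) arcs_trans:
  assumes "(u, v) \<in> parcs G" "(v, w) \<in> parcs G"
  shows "(u, w) \<in> parcs G"
proof (rule ccontr)
  assume no: "(u, w) \<notin> parcs G"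
  have V: "u \<in> pverts G" "v \<in> pverts G" "w \<in> pverts G" using assms in_arcsD1 in_arcsD2 by auto
  have ne: "u \<noteq> v" "v \<noteq> w" using assms pair_no_loops by force+
  have "u \<noteq> w" using ex1_arc[OF V(1,2) ne(1)] assms by auto
  then have wu: "(w, u) \<in> parcs G" using ex1_arc[OF V(1,3)] no by auto
  have "cycle [(u, v), (v, w), (w, u)]"
    unfolding cycle_def awalk_def using assms wu V ne \<open>u \<noteq> w\<close> by auto
  then show False using acyclic by blast
qed

lemma card_hamilton_cycles_C3:
  assumes T: "transitive_triple m T1 T2 T3" and m: "m > 0"
  shows "real (card (hamilton_cycles (C3 T1 T2 T3))) = (\<Sum>k=1..m. real (num_surj m k) ^ 3 / real k)"
proof -
  interpret T1: transitive_tournament T1 using T by (simp add: transitive_triple_def)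
  interpret T2: transitive_tournament T2 using T by (simp add: transitive_triple_def)
  interpret T3: transitive_tournament T3 using T by (simp add: transitive_triple_def)
  let ?V1 = "pverts T1" and ?V2 = "pverts T2" and ?V3 = "pverts T3"
  have disj: "?V1 \<inter> ?V2 = {}" "?V2 \<inter> ?V3 = {}" "?V3 \<inter> ?V1 = {}"
    and card: "card ?V1 = m" "card ?V2 = m" "card ?V3 = m"
    using T by (auto simp: transitive_triple_def)
  define V where "V = ?V1 \<union> ?V2 \<union> ?V3"
  define ty where "ty v = (if v \<in> ?V1 then 0 else if v \<in> ?V2 then 1 else 2 :: nat)" for v
  define lt where "lt u v \<longleftrightarrow> (u, v) \<in> parcs T1 \<union> parcs T2 \<union> parcs T3" for u v
  have ty_iff: "ty v = 0 \<longleftrightarrow> v \<in> ?V1" "ty v = 1 \<longleftrightarrow> v \<in> ?V2" "ty v = 2 \<longleftrightarrow> v \<in> ?V3" if "v \<in> V" for v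
    using that disj by (auto simp: ty_def V_def)
  have lt1: "lt u v \<longleftrightarrow> (u, v) \<in> parcs T1" if "u \<in> ?V1" for u v
    using that disj T2.in_arcsD1 T3.in_arcsD1 unfolding lt_def by blast
  have lt2: "lt u v \<longleftrightarrow> (u, v) \<in> parcs T2" if "u \<in> ?V2" for u v
    using that disj T1.in_arcsD1 T3.in_arcsD1 unfolding lt_def by blast
  have lt3: "lt u v \<longleftrightarrow> (u, v) \<in> parcs T3" if "u \<in> ?V3" for u v
    using that disj T1.in_arcsD1 T2.in_arcsD1 unfolding lt_def by blast
  \<comment> \<open>Treats the three parts uniformly: each order axiom is then proved once, in the
    tournament containing u, instead of by cases.\<close>
  define part_of where "part_of T u \<longleftrightarrow> transitive_tournament T \<and> u \<in> pverts T \<and>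
      (\<forall>v\<in>V. ty v = ty u \<longleftrightarrow> v \<in> pverts T) \<and> (\<forall>v\<in>pverts T. \<forall>w. lt v w \<longleftrightarrow> (v, w) \<in> parcs T)" for T u
  have part: "\<exists>T. part_of T u" if u: "u \<in> V" for u
  proof -
    consider "u \<in> ?V1" | "u \<in> ?V2" | "u \<in> ?V3" using u by (auto simp: V_def)
    then show ?thesis
    proof cases
      case 1
      then have "ty u = 0" using ty_iff[OF u] by simp
      then have "part_of T1 u" unfolding part_of_def using 1 ty_iff lt1 T1.transitive_tournament_axioms by simp
      then show ?thesis ..
    next
      case 2
      then have "ty u = 1" using ty_iff[OF u] by simp
      then have "part_of T2 u" unfolding part_of_def using 2 ty_iff lt2 T2.transitive_tournament_axioms by simp
      then show ?thesis ..
    next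
      case 3
      then have "ty u = 2" using ty_iff[OF u] by simp
      then have "part_of T3 u" unfolding part_of_def using 3 ty_iff lt3 T3.transitive_tournament_axioms by simp
      then show ?thesis ..
    qed
  qed
  have part_ofD: "transitive_tournament T" "u \<in> pverts T"
      "\<And>v. v \<in> V \<Longrightarrow> ty v = ty u \<Longrightarrow> v \<in> pverts T" "\<And>v w. v \<in> pverts T \<Longrightarrow> lt v w \<longleftrightarrow> (v, w) \<in> parcs T"
    if "part_of T u" for T u
    using that unfolding part_of_def by simp_all
  interpret cyclic_blocks V ty lt "parcs (C3 T1 T2 T3)"
  proof
    show "finite V" unfolding V_def using T1.pair_finite_verts T2.pair_finite_verts T3.pair_finite_verts by simp
    show "ty v < 3" for v by (simp add: ty_def)
    show "\<exists>v\<in>V. ty v = i" if "i < 3" for i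
    proof -
      have "?V1 \<noteq> {}" "?V2 \<noteq> {}" "?V3 \<noteq> {}" using card m by auto
      then obtain v1 v2 v3 where v: "v1 \<in> ?V1" "v2 \<in> ?V2" "v3 \<in> ?V3" by blast
      then have V: "v1 \<in> V" "v2 \<in> V" "v3 \<in> V" by (simp_all add: V_def)
      then have "ty v1 = 0" "ty v2 = 1" "ty v3 = 2" using v ty_iff by blast+
      moreover have "i = 0 \<or> i = 1 \<or> i = 2" using that by auto
      ultimately show ?thesis using V by blast
    qed
    show "\<not> lt v v" if v: "v \<in> V" for v
    proof
      assume lt: "lt v v"
      obtain T where T: "part_of T v" using part[OF v] by (rule exE)
      interpret T: transitive_tournament T by (rule part_ofD(1)[OF T])
      have "(v, v) \<in> parcs T" using lt part_ofD(4)[OF T part_ofD(2)[OF T]] by simp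
      then show False using T.pair_no_loops[of "(v, v)"] by simp
    qed
    show "lt u w" if h: "u \<in> V" "v \<in> V" "w \<in> V" "ty u = ty v" "ty v = ty w" "lt u v" "lt v w" for u v w
    proof -
      obtain T where T: "part_of T u" using part[OF h(1)] by (rule exE)
      interpret T: transitive_tournament T by (rule part_ofD(1)[OF T])
      have u: "u \<in> pverts T" by (rule part_ofD(2)[OF T])
      have v: "v \<in> pverts T" using part_ofD(3)[OF T h(2)] h(4) by simp
      have "(u, v) \<in> parcs T" "(v, w) \<in> parcs T"
        using h(6,7) part_ofD(4)[OF T u] part_ofD(4)[OF T v] by simp_all
      then have "(u, w) \<in> parcs T" by (rule T.arcs_trans)
      then show ?thesis using part_ofD(4)[OF T u] by simp
    qed
    show "lt u v \<or> lt v u" if h: "u \<in> V" "v \<in> V" "ty u = ty v" "u \<noteq> v" for u v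
    proof -
      obtain T where T: "part_of T u" using part[OF h(1)] by (rule exE)
      interpret T: transitive_tournament T by (rule part_ofD(1)[OF T])
      have u: "u \<in> pverts T" by (rule part_ofD(2)[OF T])
      have v: "v \<in> pverts T" using part_ofD(3)[OF T h(2)] h(3) by simp
      show ?thesis
        using T.ex1_arc[OF u v h(4)] part_ofD(4)[OF T u, of v] part_ofD(4)[OF T v, of u] by metis
    qed
    show "(u, v) \<in> parcs (C3 T1 T2 T3) \<longleftrightarrow> (ty u = ty v \<and> lt u v) \<or> ty v = Suc (ty u) mod 3"
      if uv: "u \<in> V" "v \<in> V" for u v
    proof -
      have same: "ty u = ty v" if "lt u v"
        using that ty_iff[OF uv(1)] ty_iff[OF uv(2)] T1.wellformed' T2.wellformed' T3.wellformed'
        unfolding lt_def by (metis UnE)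
      have "ty v = Suc (ty u) mod 3 \<longleftrightarrow> (u, v) \<in> ?V1 \<times> ?V2 \<union> ?V2 \<times> ?V3 \<union> ?V3 \<times> ?V1"
      proof -
        consider "u \<in> ?V1" | "u \<in> ?V2" | "u \<in> ?V3" using uv by (auto simp: V_def)
        then show ?thesis
          by cases (use ty_iff[OF uv(1)] ty_iff[OF uv(2)] disj in \<open>auto\<close>)
      qed
      then show ?thesis using same unfolding lt_def by (auto simp: C3_def)
    qed
  qed
  have "card {v \<in> V. ty v = i} = m" if "i < 3" for i
  proof -
    have "i = 0 \<or> i = 1 \<or> i = 2" using that by auto
    moreover have "{v \<in> V. ty v = 0} = ?V1" "{v \<in> V. ty v = 1} = ?V2" "{v \<in> V. ty v = 2} = ?V3"
      using ty_iff by (auto simp: V_def)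
    ultimately show ?thesis using card by auto
  qed
  from card_cycles[OF this]
  have "real (card (cyc_arcs ` seqs)) = (\<Sum>k=1..m. real (num_surj m k) ^ 3 / real k)" .
  moreover have "hamilton_cycles (C3 T1 T2 T3) = cyc_arcs ` seqs"
    unfolding hamilton_cycles_conv seqs_def by (simp add: C3_def V_def)
  ultimately show ?thesis by simp
qed

text \<open>Supplies an actual triple with natural numbers as vertices. Without one the condition in
  \<open>h\<close> would hold for every k, and \<open>THE\<close> would determine nothing.\<close>

definition interval_tournament :: "nat \<Rightarrow> nat \<Rightarrow> nat pair_pre_digraph" where
  "interval_tournament a b = \<lparr>pverts = {a..<b}, parcs = {(u, v). a \<le> u \<and> u < v \<and> v < b}\<rparr>"

lemma pcas_increasing:
  assumes "pcas u p v" "p \<noteq> []" "\<And>e. e \<in> set p \<Longrightarrow> fst e < (snd e :: nat)"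
  shows "u < v"
  using assms
proof (induction p arbitrary: u)
  case (Cons e es)
  have "u < snd e" using Cons.prems by auto
  moreover have "snd e \<le> v"
  proof (cases "es = []")
    case False
    then have "snd e < v" using Cons.prems by (intro Cons.IH) auto
    then show ?thesis by simp
  qed (use Cons.prems in auto)
  ultimately show ?case by simp
qed simp

lemma transitive_interval_tournament: "transitive_tournament (interval_tournament a b)"
proof
  let ?G = "interval_tournament a b"
  show "finite (parcs ?G)"
    by (rule finite_subset[of _ "{a..<b} \<times> {a..<b}"]) (auto simp: interval_tournament_def)
  show "\<nexists>p. pre_digraph.cycle (with_proj ?G) p"
  proof
    assume "\<exists>p. pre_digraph.cycle (with_proj ?G) p"
    then obtain p u where p: "pcas u p u" "p \<noteq> []" "set p \<subseteq> parcs ?G"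
      by (auto simp: pre_digraph.cycle_def pre_digraph.awalk_def cas_with_proj_eq)
    have "fst e < snd e" if "e \<in> set p" for e
      using that p(3) by (auto simp: interval_tournament_def)
    then have "u < u" by (rule pcas_increasing[OF p(1,2)])
    then show False by simp
  qed
qed (auto simp: interval_tournament_def)

lemma transitive_triple_interval:
  "transitive_triple m (interval_tournament 0 m) (interval_tournament m (2 * m)) (interval_tournament (2 * m) (3 * m))"
proof -
  have "pverts (interval_tournament a b) = {a..<b}" for a b by (simp add: interval_tournament_def)
  then show ?thesis
    unfolding transitive_triple_def using transitive_interval_tournament by auto
qed

lemma h_eq:
  assumes "0 < n" "3 dvd n"
  shows "real (h n) = (\<Sum>k=1..n div 3. real (num_surj (n div 3) k) ^ 3 / real k)"
proof -
  let ?m = "n div 3"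
  have m: "?m > 0" using assms by (auto elim!: dvdE)
  let ?c = "card (hamilton_cycles (C3 (interval_tournament 0 ?m) (interval_tournament ?m (2 * ?m)) (interval_tournament (2 * ?m) (3 * ?m))))"
  have c: "real ?c = (\<Sum>k=1..?m. real (num_surj ?m k) ^ 3 / real k)"
    by (rule card_hamilton_cycles_C3[OF transitive_triple_interval m])
  have "h n = ?c"
    unfolding h_def
  proof (rule the_equality)
    show "\<forall>T1 T2 T3 :: nat pair_pre_digraph. transitive_triple ?m T1 T2 T3 \<longrightarrow> card (hamilton_cycles (C3 T1 T2 T3)) = ?c"
    proof (intro allI impI)
      fix T1 T2 T3 :: "nat pair_pre_digraph" assume "transitive_triple ?m T1 T2 T3"
      then have "real (card (hamilton_cycles (C3 T1 T2 T3))) = real ?c"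
        unfolding c using m by (rule card_hamilton_cycles_C3)
      then show "card (hamilton_cycles (C3 T1 T2 T3)) = ?c" by simp
    qed
  qed (use transitive_triple_interval in blast)
  then show ?thesis using c by simp
qed

theorem corollary2:
  shows "(\<forall>n T1 T2 (T3 :: 'a pair_pre_digraph).
            0 < n \<and> 3 dvd n \<and> transitive_triple (n div 3) T1 T2 T3 \<longrightarrow>
              card (hamilton_cycles (C3 T1 T2 T3)) = h n) \<and>
         asymp_equiv (\<lambda>n. real (h n)) (inf at_top (principal {n. 3 dvd n}))
           (\<lambda>n. 1 / (1 - ln 2) * (fact (n - 1) / (3 * ln 2) ^ n))"
proof
  show "\<forall>n T1 T2 (T3 :: 'a pair_pre_digraph).
            0 < n \<and> 3 dvd n \<and> transitive_triple (n div 3) T1 T2 T3 \<longrightarrow>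
              card (hamilton_cycles (C3 T1 T2 T3)) = h n"
  proof (intro allI impI)
    fix n and T1 T2 T3 :: "'a pair_pre_digraph"
    assume *: "0 < n \<and> 3 dvd n \<and> transitive_triple (n div 3) T1 T2 T3"
    then have "n div 3 > 0" by (auto elim!: dvdE)
    then have "real (card (hamilton_cycles (C3 T1 T2 T3))) = real (h n)"
      \<comment> \<open>Both counts equal the same sum over k, whatever the vertex type.\<close>
      using card_hamilton_cycles_C3[of "n div 3" T1 T2 T3] h_eq[of n] * by simp
    then show "card (hamilton_cycles (C3 T1 T2 T3)) = h n" by simp
  qed
  let ?F = "inf at_top (principal {n::nat. 3 dvd n})"
  let ?Q = "\<lambda>m. (\<Sum>k=1..m. real (num_surj m k) ^ 3 / real k) / (1 / (1 - ln 2) * (fact (3 * m - 1) / (3 * ln 2) ^ (3 * m)))"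
  have "filterlim (\<lambda>n::nat. n div 3) at_top at_top"
    unfolding filterlim_at_top
  proof
    fix Z :: nat
    show "eventually (\<lambda>n. Z \<le> n div 3) at_top"
      using eventually_ge_at_top[of "3 * Z"] by eventually_elim auto
  qed
  then have "filterlim (\<lambda>n::nat. n div 3) at_top ?F" by (rule filterlim_mono) auto
  then have lim: "((\<lambda>n. ?Q (n div 3)) \<longlongrightarrow> 1) ?F"
    by (rule filterlim_compose[OF surjection_sum_asymptotics])
  show "asymp_equiv (\<lambda>n. real (h n)) ?F (\<lambda>n. 1 / (1 - ln 2) * (fact (n - 1) / (3 * ln 2) ^ n))"
  proof (rule asymp_equivI', rule Lim_transform_eventually[OF lim])
    \<comment> \<open>The two quotients agree only where 3 (n div 3) = n, which is what the
      principal filter provides.\<close>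
    show "eventually (\<lambda>n. ?Q (n div 3) = real (h n) / (1 / (1 - ln 2) * (fact (n - 1) / (3 * ln 2) ^ n))) ?F"
      unfolding eventually_inf_principal using eventually_gt_at_top[of 0]
    proof (eventually_elim, intro impI)
      fix n :: nat assume n: "0 < n" "n \<in> {n. 3 dvd n}"
      then have "3 * (n div 3) = n" by simp
      then show "?Q (n div 3) = real (h n) / (1 / (1 - ln 2) * (fact (n - 1) / (3 * ln 2) ^ n))"
        using h_eq[of n] n by simp
    qed
  qed
qed

end
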